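(* Let $(\Sigma^n,\partial\Sigma)$ be a properly immersed connected self-translater in $\mathbb{R}^{n+1}$, with (possibly empty) compact boundary $\partial\Sigma$. Let $\pi:\mathbb{R}^{n+1}\to\mathbb{R}^n$ be the projection in the direction of translation, $\pi(x_1,\dots,x_n,x_{n+1})=(x_1,\dots,x_n)$. Then exactly one of the following holds: \begin{enumerate} \item $\operatorname{Conv}(\pi(\Sigma))=\mathbb{R}^n$; \item $\operatorname{Conv}(\pi(\Sigma))$ is a halfspace of $\mathbb{R}^n$; \item $\operatorname{Conv}(\pi(\Sigma))$ is a closed slab between two parallel hyperplanes of $\mathbb{R}^n$; \item $\operatorname{Conv}(\pi(\Sigma))$ is a hyperplane in $\mathbb{R}^n$; \item $\operatorname{Conv}(\pi(\Sigma))$ is a compact convex set. This case occurs precisely when $\Sigma$ is compact. \end{enumerate}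
   Context: A self-translater $\Sigma^n\subseteq\mathbb{R}^{n+1}$ (with velocity $e_{n+1}$) is a smooth immersed hypersurface, possibly with boundary, satisfying $\boldsymbol{H}=\langle e_{n+1},\nu\rangle\,\nu$, where $\boldsymbol{H}$ is the mean curvature vector (the trace of the vector-valued second fundamental form $A(X,Y)=(\nabla^{\mathbb{R}^{n+1}}_XY)^\perp$), $\nu$ is a unit normal, and $e_{n+1}$ is the last standard basis vector of $\mathbb{R}^{n+1}$. $\pi(\Sigma)$ denotes the projection of the image of the immersion, and $\operatorname{Conv}(\cdot)$ denotes the convex hull. Hyperplanes and halfspaces are affine.
   Formalization: Conv is taken as the closed convex hull (the plain hull of a projected grim reaper cylinder is an open slab, none of the five cases), halfspaces are closed, and n ≥ 2 is assumed (for n = 1 a compact interval is both a slab and compact, and a point is both a hyperplane and compact). *)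

theory Defs
  imports "HOL-Analysis.Analysis"
begin

section \<open>Smooth maps\<close>

primrec continuously_differentiable_on ::
  "nat \<Rightarrow> 'a::euclidean_space set \<Rightarrow> ('a \<Rightarrow> 'b::euclidean_space) \<Rightarrow> bool" where
  "continuously_differentiable_on 0 S f \<longleftrightarrow> continuous_on S f"
| "continuously_differentiable_on (Suc k) S f \<longleftrightarrow>
     (\<forall>x\<in>S. f differentiable at x) \<and>
     (\<forall>v. continuously_differentiable_on k S (\<lambda>x. frechet_derivative f (at x) v))"

text \<open>On a set that need not be open (a piece of a halfspace containing boundary points),
  smoothness means the local existence of smooth extensions to open sets.\<close>

definition smooth_on :: "'a::euclidean_space set \<Rightarrow> ('a \<Rightarrow> 'b::euclidean_space) \<Rightarrow> bool" where
  "smooth_on S f \<longleftrightarrow>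
     (\<forall>x\<in>S. \<exists>U g. open U \<and> x \<in> U \<and> (\<forall>k. continuously_differentiable_on k U g) \<and>
                   (\<forall>y\<in>S \<inter> U. g y = f y))"

section \<open>Smooth manifolds with boundary\<close>

type_synonym ('m, 'n) chart = "'m set \<times> ('m \<Rightarrow> real ^ 'n)"

abbreviation chart_image :: "('m, 'n::finite) chart \<Rightarrow> (real ^ 'n) set" where
  "chart_image c \<equiv> snd c ` fst c"

abbreviation chart_inv :: "('m, 'n::finite) chart \<Rightarrow> real ^ 'n \<Rightarrow> 'm" where
  "chart_inv c \<equiv> inv_into (fst c) (snd c)"

definition is_chart :: "'m topology \<Rightarrow> ('m, 'n::finite) chart \<Rightarrow> bool" where
  "is_chart X c \<longleftrightarrow>
     openin X (fst c) \<and>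
     (open (chart_image c) \<or>
      (\<exists>k. openin (top_of_set {x. 0 \<le> x $ k}) (chart_image c))) \<and>
     homeomorphic_map (subtopology X (fst c)) (top_of_set (chart_image c)) (snd c)"

definition smooth_manifold_with_boundary ::
  "'m topology \<Rightarrow> ('m, 'n::finite) chart set \<Rightarrow> bool" where
  "smooth_manifold_with_boundary X A \<longleftrightarrow>
     Hausdorff_space X \<and> second_countable X \<and>
     (\<forall>c\<in>A. is_chart X c) \<and>
     (\<Union>c\<in>A. fst c) = topspace X \<and>
     (\<forall>c\<in>A. \<forall>d\<in>A. smooth_on (snd c ` (fst c \<inter> fst d)) (snd d \<circ> chart_inv c))"

text \<open>The interior is taken in \<open>real ^ 'n\<close>: in a chart onto a relatively open subset of a
  halfspace, the points outside it are those on the bounding hyperplane.\<close>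

definition manifold_boundary :: "('m, 'n::finite) chart set \<Rightarrow> 'm set" where
  "manifold_boundary A = {p. \<exists>c\<in>A. p \<in> fst c \<and> snd c p \<notin> interior (chart_image c)}"

definition smooth_immersion ::
  "('m, 'n::finite) chart set \<Rightarrow> ('m \<Rightarrow> 'b::euclidean_space) \<Rightarrow> bool" where
  "smooth_immersion A F \<longleftrightarrow>
     (\<forall>c\<in>A. smooth_on (chart_image c) (F \<circ> chart_inv c) \<and>
       (\<forall>x\<in>chart_image c.
          inj (frechet_derivative (F \<circ> chart_inv c) (at x within chart_image c))))"

section \<open>Mean curvature of a local parametrization\<close>

text \<open>Below, \<open>r\<close> is a smooth immersion of \<open>V\<close>, where \<open>V\<close> is open or relatively open in a
  halfspace, so that derivatives within \<open>V\<close> are unique.\<close>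

definition tangent_space ::
  "(real ^ 'n::finite) set \<Rightarrow> (real ^ 'n \<Rightarrow> 'b::euclidean_space) \<Rightarrow> real ^ 'n \<Rightarrow> 'b set" where
  "tangent_space V r x = range (frechet_derivative r (at x within V))"

definition second_derivative ::
  "(real ^ 'n::finite) set \<Rightarrow> (real ^ 'n \<Rightarrow> 'b::euclidean_space) \<Rightarrow> real ^ 'n \<Rightarrow>
     real ^ 'n \<Rightarrow> real ^ 'n \<Rightarrow> 'b" where
  "second_derivative V r x u v =
     frechet_derivative (\<lambda>y. frechet_derivative r (at y within V) v) (at x within V) u"

definition normal_component :: "'b::euclidean_space set \<Rightarrow> 'b \<Rightarrow> 'b" where
  "normal_component T w = (THE z. z \<in> T\<^sup>\<bottom> \<and> w - z \<in> T)"

text \<open>The ambient derivative of the coordinate field \<open>dr v\<close> in the direction \<open>dr u\<close> is the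
  second derivative of \<open>r\<close>, so the following is the value of the second fundamental form at
  \<open>dr u\<close> and \<open>dr v\<close>. Its trace with respect to the induced metric is taken in coordinates.\<close>

definition second_fundamental_form ::
  "(real ^ 'n::finite) set \<Rightarrow> (real ^ 'n \<Rightarrow> 'b::euclidean_space) \<Rightarrow> real ^ 'n \<Rightarrow>
     real ^ 'n \<Rightarrow> real ^ 'n \<Rightarrow> 'b" where
  "second_fundamental_form V r x u v =
     normal_component (tangent_space V r x) (second_derivative V r x u v)"

definition induced_metric ::
  "(real ^ 'n::finite) set \<Rightarrow> (real ^ 'n \<Rightarrow> 'b::euclidean_space) \<Rightarrow> real ^ 'n \<Rightarrow>
     real ^ 'n ^ 'n" where
  "induced_metric V r x =
     (\<chi> i j. frechet_derivative r (at x within V) (axis i 1) \<bullet>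
             frechet_derivative r (at x within V) (axis j 1))"

definition mean_curvature_vector ::
  "(real ^ 'n::finite) set \<Rightarrow> (real ^ 'n \<Rightarrow> 'b::euclidean_space) \<Rightarrow> real ^ 'n \<Rightarrow> 'b" where
  "mean_curvature_vector V r x =
     (\<Sum>i\<in>UNIV. \<Sum>j\<in>UNIV. matrix_inv (induced_metric V r x) $ i $ j *\<^sub>R
        second_fundamental_form V r x (axis i 1) (axis j 1))"

section \<open>Self-translaters\<close>

text \<open>The ambient space of dimension \<open>CARD('n) + 1\<close> is \<open>(real ^ 'n) \<times> real\<close> with its Euclidean
  inner product; the last coordinate is the second component, so the last standard basis
  vector is \<open>(0, 1)\<close> and the projection along it is \<open>fst\<close>. The equation does not depend on
  the sign of \<open>\<nu>\<close>, so no orientation is needed.\<close>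

definition translater_equation ::
  "('m, 'n::finite) chart set \<Rightarrow> ('m \<Rightarrow> (real ^ 'n) \<times> real) \<Rightarrow> bool" where
  "translater_equation A F \<longleftrightarrow>
     (\<forall>c\<in>A. \<forall>x\<in>chart_image c. \<forall>\<nu>.
        norm \<nu> = 1 \<and> \<nu> \<in> (tangent_space (chart_image c) (F \<circ> chart_inv c) x)\<^sup>\<bottom> \<longrightarrow>
        mean_curvature_vector (chart_image c) (F \<circ> chart_inv c) x = ((0, 1) \<bullet> \<nu>) *\<^sub>R \<nu>)"

definition self_translater ::
  "'m topology \<Rightarrow> ('m, 'n::finite) chart set \<Rightarrow> ('m \<Rightarrow> (real ^ 'n) \<times> real) \<Rightarrow> bool" where
  "self_translater X A F \<longleftrightarrow>
     smooth_manifold_with_boundary X A \<and> smooth_immersion A F \<and> translater_equation A F"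

section \<open>Convex sets\<close>

text \<open>\<open>Conv\<close> is the closed convex hull. The closure matters: the grim reaper cylinder in
  dimension 3 is complete and without boundary, and its projection is an open slab.\<close>

definition Conv :: "'a::euclidean_space set \<Rightarrow> 'a set" where
  "Conv S = closure (convex hull S)"

definition is_hyperplane :: "'a::euclidean_space set \<Rightarrow> bool" where
  "is_hyperplane C \<longleftrightarrow> (\<exists>a b. a \<noteq> 0 \<and> C = {x. a \<bullet> x = b})"

definition is_halfspace :: "'a::euclidean_space set \<Rightarrow> bool" where
  "is_halfspace C \<longleftrightarrow> (\<exists>a b. a \<noteq> 0 \<and> C = {x. a \<bullet> x \<le> b})"

definition is_closed_slab :: "'a::euclidean_space set \<Rightarrow> bool" where
  "is_closed_slab C \<longleftrightarrow> (\<exists>a b c. a \<noteq> 0 \<and> b < c \<and> C = {x. b \<le> a \<bullet> x \<and> a \<bullet> x \<le> c})"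

end

theory Submission
  imports Defs
begin

text \<open>The tool is the maximum principle for the operator \<open>L u = tr\<^sub>T D\<^sup>2u + \<partial>u/\<partial>z\<close>, where \<open>u\<close> is a
  function on the ambient space, \<open>T\<close> is the tangent space of the translater and \<open>z\<close> is the last
  coordinate. On a translater the mean curvature vector is the normal part of \<open>e = (0, 1)\<close>, so \<open>L\<close>
  is the Laplacian plus the derivative along the tangential part of \<open>e\<close>, and a function with
  \<open>L u > 0\<close> has no interior local maximum along the surface (\<open>translater_local_max\<close>). The
  horizontal coordinates satisfy \<open>L x\<^sub>i = 0\<close>, and \<open>L z = 1\<close>.

  The geometric core is a wedge theorem (\<open>compact_if_nonparallel_halfspaces\<close>): a proper translater
  with compact boundary that lies in two vertical halfspaces with nonparallel boundaries is compact.
  Let \<open>s \<ge> 0\<close> (the depth) be the coordinate along the axis of the wedge and \<open>t\<close> the transverse one,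
  so that \<open>|t| \<le> \<kappa> s\<close>. Three comparison functions are used.

  First, the part \<open>{s \<le> b}\<close> of the surface is bounded (\<open>depth_sublevel_bounded\<close>). The function
  \<open>s\<^sup>2 + t\<^sup>2 - 2 M s\<close> is strictly subsolutional, since at most one dimension of the \<open>(s, t)\<close>-plane is
  lost in \<open>T\<close>, and for large \<open>M\<close> it is smaller on the cut \<open>{s = 2 b + 1}\<close> than on \<open>{s \<le> b}\<close>.
  Subtract a small multiple of a function that grows away from a point \<open>p\<close> with depth at most \<open>b\<close>.
  The maximum is then taken on the boundary of the surface, which forces \<open>p\<close> to be near it.

  Secondly, \<open>- exp (- z / 2) - \<epsilon> s\<close> bounds the height by its maximum on the boundary
  (\<open>height_le_boundary_height\<close>). Thirdly, \<open>z + s (b - s) / 4\<close> equals \<open>z\<close> on the cut \<open>{s = b}\<close>,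
  where \<open>z\<close> is bounded above; as \<open>b\<close> grows, a point deeper than the whole boundary would
  exceed the values at the cut and at the boundary (\<open>depth_le_boundary_depth\<close>). Thus the depth is
  bounded, and by the first step so is the surface.

  If the translater is not compact, then by the wedge theorem all supporting halfspaces of the
  hull are parallel, and a nonempty closed convex set with this property is the whole space, a
  halfspace, a slab or a hyperplane (\<open>parallel_supports_classification\<close>). In dimension at least two
  none of these is bounded, which separates them from the compact case.\<close>

section \<open>Traces in orthonormal bases\<close>

definition orthonormal :: "'a::real_inner set \<Rightarrow> bool" where
  "orthonormal B \<longleftrightarrow> pairwise orthogonal B \<and> (\<forall>\<tau>\<in>B. norm \<tau> = 1)"

lemma orthonormal_imp_finite: "orthonormal (B::'a::euclidean_space set) \<Longrightarrow> finite B"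
  unfolding orthonormal_def by (meson pairwise_orthogonal_imp_finite)

lemma second_derivative_test_local_max:
  fixes h h' :: "real \<Rightarrow> real"
  assumes d: "d > 0"
    and h: "\<And>t. \<bar>t\<bar> < d \<Longrightarrow> (h has_real_derivative h' t) (at t)"
    and h': "(h' has_real_derivative c) (at 0)"
    and max: "\<And>t. \<bar>t\<bar> < d \<Longrightarrow> h t \<le> h 0"
  shows "h' 0 = 0" "c \<le> 0"
proof -
  show crit: "h' 0 = 0"
    using DERIV_local_max[OF h[of 0] d] max d by auto
  show "c \<le> 0"
  proof (rule ccontr)
    assume "\<not> c \<le> 0"
    then obtain e where e: "e > 0" "\<And>t. t > 0 \<Longrightarrow> t < e \<Longrightarrow> h' 0 < h' t"
      using DERIV_pos_inc_right[OF h', simplified] by auto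
    define t where "t = min d e / 2"
    have t: "0 < t" "t < d" "t < e" using d e by (auto simp: t_def)
    obtain \<xi> where \<xi>: "0 < \<xi>" "\<xi> < t" "h t - h 0 = (t - 0) * h' \<xi>"
      using MVT2[of 0 t h h'] h t by (auto simp: abs_if)
    have "h' \<xi> > 0" using e(2)[of \<xi>] \<xi> t crit by auto
    then have "t * h' \<xi> > 0" using t by simp
    moreover have "h t - h 0 = t * h' \<xi>" using \<xi>(3) by simp
    ultimately have "h t > h 0" by linarith
    then show False using max[of t] t by auto
  qed
qed

lemma matrix_inv_eqI:
  fixes P Q :: "real ^ 'n ^ 'n"
  assumes "P ** Q = mat 1"
  shows "matrix_inv P = Q"
proof -
  have QP: "Q ** P = mat 1" using assms matrix_left_right_inverse by blast
  have inv: "P ** matrix_inv P = mat 1 \<and> matrix_inv P ** P = mat 1"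
    unfolding matrix_inv_def by (rule someI[of _ Q]) (use assms QP in auto)
  then have "matrix_inv P = (Q ** P) ** matrix_inv P" using QP by simp
  also have "\<dots> = Q ** (P ** matrix_inv P)" by (simp add: matrix_mul_assoc)
  also have "\<dots> = Q" using inv by simp
  finally show ?thesis .
qed

text \<open>If \<open>\<tau> = J v\<^sub>\<tau>\<close> runs through an orthonormal basis of the range of \<open>J\<close>, then the inverse of the Gram
  matrix of \<open>J\<close> is the sum of the matrices \<open>v\<^sub>\<tau> v\<^sub>\<tau>\<^sup>T\<close>. So a trace taken in coordinates with the inverse
  metric, as in the definition of the mean curvature, is a sum over an orthonormal basis of the
  tangent space, to which a test in each single direction applies.\<close>

lemma trace_inverse_gram:
  fixes J :: "real ^ 'n \<Rightarrow> 'b::euclidean_space" and Q :: "real ^ 'n \<Rightarrow> real ^ 'n \<Rightarrow> real"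
  assumes J: "linear J" "inj J" and B: "orthonormal B" "span B = range J" and Q: "bilinear Q"
  shows "(\<Sum>i\<in>UNIV. \<Sum>j\<in>UNIV.
            matrix_inv (\<chi> i j. J (axis i 1) \<bullet> J (axis j 1)) $ i $ j * Q (axis i 1) (axis j 1)) =
         (\<Sum>\<tau>\<in>B. Q (inv J \<tau>) (inv J \<tau>))"
proof -
  define v where "v = inv J"
  define P :: "real ^ 'n ^ 'n" where "P = (\<chi> i j. \<Sum>\<tau>\<in>B. v \<tau> $ i * v \<tau> $ j)"
  have fin: "finite B" using B orthonormal_imp_finite by auto
  have Jv: "J (v \<tau>) = \<tau>" if "\<tau> \<in> B" for \<tau>
    unfolding v_def using that B span_base[of \<tau> B] f_inv_into_f[of \<tau> J UNIV] by simp
  have expand: "(\<Sum>\<tau>\<in>B. (J x \<bullet> \<tau>) *\<^sub>R v \<tau>) = x" for x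
  proof -
    have "J (\<Sum>\<tau>\<in>B. (J x \<bullet> \<tau>) *\<^sub>R v \<tau>) = (\<Sum>\<tau>\<in>B. (J x \<bullet> \<tau>) *\<^sub>R \<tau>)"
      by (simp add: linear_sum[OF J(1)] linear_scale[OF J(1)] Jv)
    also have "\<dots> = J x"
      using B fin by (intro orthonormal_basis_expand) (auto simp: orthonormal_def)
    finally show ?thesis using J(2) by (simp add: inj_eq)
  qed
  have basis: "x = (\<Sum>j\<in>UNIV. x $ j *\<^sub>R axis j 1)" for x :: "real ^ 'n"
    using basis_expansion[of x] by (simp add: scalar_mult_eq_scaleR)
  have Jbasis: "J y = (\<Sum>j\<in>UNIV. y $ j *\<^sub>R J (axis j 1))" for y
  proof -
    have "J y = J (\<Sum>j\<in>UNIV. y $ j *\<^sub>R axis j 1)" using basis[of y] by simp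
    then show ?thesis by (simp add: linear_sum[OF J(1)] linear_scale[OF J(1)])
  qed
  have "(\<chi> i j. J (axis i 1) \<bullet> J (axis j 1)) ** P = mat 1"
  proof -
    have "(\<Sum>k\<in>UNIV. (J (axis i 1) \<bullet> J (axis k 1)) * (\<Sum>\<tau>\<in>B. v \<tau> $ k * v \<tau> $ j)) =
        (if i = j then 1 else 0)" for i j
    proof -
      have "(\<Sum>k\<in>UNIV. (J (axis i 1) \<bullet> J (axis k 1)) * (\<Sum>\<tau>\<in>B. v \<tau> $ k * v \<tau> $ j)) =
          (\<Sum>\<tau>\<in>B. (J (axis i 1) \<bullet> (\<Sum>k\<in>UNIV. v \<tau> $ k *\<^sub>R J (axis k 1))) * v \<tau> $ j)"
        by (simp add: inner_sum_right sum_distrib_left sum_distrib_right mult_ac)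
           (rule sum.swap)
      also have "\<dots> = (\<Sum>\<tau>\<in>B. (J (axis i 1) \<bullet> \<tau>) * v \<tau> $ j)"
        by (intro sum.cong refl) (simp add: Jbasis[symmetric] Jv)
      also have "\<dots> = (\<Sum>\<tau>\<in>B. (J (axis i 1) \<bullet> \<tau>) *\<^sub>R v \<tau>) $ j" by simp
      also have "\<dots> = axis i 1 $ j" by (simp only: expand)
      finally show ?thesis by (auto simp: axis_def)
    qed
    then show ?thesis
      by (simp add: matrix_matrix_mult_def mat_def P_def vec_eq_iff)
  qed
  then have "matrix_inv (\<chi> i j. J (axis i 1) \<bullet> J (axis j 1)) = P" by (rule matrix_inv_eqI)
  moreover have "(\<Sum>i\<in>UNIV. \<Sum>j\<in>UNIV. P $ i $ j * Q (axis i 1) (axis j 1)) = (\<Sum>\<tau>\<in>B. Q (v \<tau>) (v \<tau>))"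
  proof -
    have Qv: "Q x x = (\<Sum>i\<in>UNIV. \<Sum>j\<in>UNIV. x $ i * x $ j * Q (axis i 1) (axis j 1))" for x
    proof -
      have "Q x x = Q (\<Sum>i\<in>UNIV. x $ i *\<^sub>R axis i 1) (\<Sum>j\<in>UNIV. x $ j *\<^sub>R axis j 1)"
        using basis[of x] by simp
      then show ?thesis
        by (simp add: bilinear_sum[OF Q] sum.cartesian_product bilinear_lmul[OF Q]
            bilinear_rmul[OF Q] mult_ac)
    qed
    have "(\<Sum>i\<in>UNIV. \<Sum>j\<in>UNIV. P $ i $ j * Q (axis i 1) (axis j 1)) =
       (\<Sum>i\<in>UNIV. \<Sum>j\<in>UNIV. \<Sum>\<tau>\<in>B. v \<tau> $ i * v \<tau> $ j * Q (axis i 1) (axis j 1))"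
      by (simp add: P_def sum_distrib_right)
    also have "\<dots> = (\<Sum>i\<in>UNIV. \<Sum>\<tau>\<in>B. \<Sum>j\<in>UNIV. v \<tau> $ i * v \<tau> $ j * Q (axis i 1) (axis j 1))"
      by (intro sum.cong refl sum.swap)
    also have "\<dots> = (\<Sum>\<tau>\<in>B. \<Sum>i\<in>UNIV. \<Sum>j\<in>UNIV. v \<tau> $ i * v \<tau> $ j * Q (axis i 1) (axis j 1))"
      by (rule sum.swap)
    finally show ?thesis by (simp add: Qv)
  qed
  ultimately show ?thesis by (simp add: v_def)
qed

text \<open>Paired with a normal vector, the second fundamental form is just the second derivative of the
  parametrization.\<close>

lemma normal_component_inner:
  assumes T: "subspace T" and n: "n \<in> T\<^sup>\<bottom>"
  shows "n \<bullet> normal_component T w = n \<bullet> w"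
proof -
  obtain y z where yz: "y \<in> span T" "\<And>x. x \<in> span T \<Longrightarrow> orthogonal z x" "w = y + z"
    using orthogonal_subspace_decomp_exists[of T w] by blast
  have sp: "span T = T" using T by (simp add: span_eq_iff)
  have ex: "z \<in> T\<^sup>\<bottom> \<and> w - z \<in> T"
    using yz sp by (auto simp: orthogonal_comp_def orthogonal_commute)
  have "z' = z" if "z' \<in> T\<^sup>\<bottom> \<and> w - z' \<in> T" for z'
  proof -
    have 1: "z' - z \<in> T\<^sup>\<bottom>" using that ex by (simp add: subspace_diff subspace_orthogonal_comp)
    have "z' - z = (w - z) - (w - z')" by simp
    then have "z' - z \<in> T" using that ex subspace_diff[OF T, of "w - z" "w - z'"] by simp
    with 1 have "orthogonal (z' - z) (z' - z)" by (auto simp: orthogonal_comp_def)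
    then show ?thesis by (simp add: orthogonal_self)
  qed
  then have "normal_component T w = z"
    unfolding normal_component_def using ex by blast
  moreover have "n \<bullet> y = 0"
    using n yz(1) sp by (auto simp: orthogonal_comp_def orthogonal_def inner_commute)
  ultimately show ?thesis using yz by (simp add: inner_add_right)
qed

section \<open>The maximum principle on a translater\<close>

text \<open>Here \<open>G\<close> is the gradient of \<open>u\<close> and \<open>D\<close> its Hessian at the point in question. At a local maximum of
  \<open>u\<close> along the surface, \<open>G\<close> is normal, and for each parameter direction \<open>v\<close> the second derivative of
  \<open>u \<circ> r\<close> along \<open>v\<close>, which is \<open>D\<^sup>2u (dr v, dr v) + G \<bullet> D\<^sup>2r (v, v)\<close>, is not positive. The sum over those
  \<open>v\<close> that \<open>dr\<close> maps to an orthonormal basis \<open>B\<close> of the tangent space contains \<open>G \<bullet> H\<close> as its second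
  part. As \<open>G\<close> is normal and \<open>H\<close> is the normal part of \<open>e\<close>, this is \<open>G \<bullet> e\<close>.\<close>

lemma parametrized_local_max:
  fixes V :: "(real ^ 'n::finite) set" and r :: "real ^ 'n \<Rightarrow> 'b::euclidean_space"
    and u :: "'b \<Rightarrow> real" and G D :: "'b \<Rightarrow> 'b"
  assumes x0: "x0 \<in> interior V" and smooth: "smooth_on V r"
    and inj: "inj (frechet_derivative r (at x0 within V))"
    and H: "\<And>\<nu>. norm \<nu> = 1 \<Longrightarrow> \<nu> \<in> (tangent_space V r x0)\<^sup>\<bottom> \<Longrightarrow>
               mean_curvature_vector V r x0 = (e \<bullet> \<nu>) *\<^sub>R \<nu>"
    and u: "\<And>y. (u has_derivative (\<lambda>h. G y \<bullet> h)) (at y)"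
    and G: "(G has_derivative D) (at (r x0))"
    and N: "open N" "x0 \<in> N" "\<And>x. x \<in> N \<Longrightarrow> u (r x) \<le> u (r x0)"
  obtains B where "orthonormal B" "card B = CARD('n)"
    "(\<Sum>\<tau>\<in>B. D \<tau> \<bullet> \<tau>) + G (r x0) \<bullet> e \<le> 0"
proof -
  have "x0 \<in> V" using x0 interior_subset by blast
  then obtain U g where U: "open U" "x0 \<in> U" and g: "\<And>k. continuously_differentiable_on k U g"
    and gr: "\<And>y. y \<in> V \<inter> U \<Longrightarrow> g y = r y"
    using smooth unfolding smooth_on_def by metis
  \<comment> \<open>On \<open>W\<close> the derivatives of \<open>r\<close> within \<open>V\<close> are the ordinary ones of the smooth extension \<open>g\<close>.\<close>
  define W where "W = interior V \<inter> U \<inter> N"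
  have W: "open W" "x0 \<in> W" "W \<subseteq> U" "W \<subseteq> interior V" "W \<subseteq> N"
    using x0 U N by (auto simp: W_def)
  have rg: "r y = g y" if "y \<in> W" for y
    using gr[of y] that W interior_subset by fastforce
  define g' where "g' y = frechet_derivative g (at y)" for y
  have dg: "(g has_derivative g' y) (at y)" if "y \<in> U" for y
    using g[of 1] that frechet_derivative_works[of g "at y"] by (simp add: g'_def)
  have dr: "(r has_derivative g' y) (at y)" if "y \<in> W" for y
    using has_derivative_transform_within_open[OF dg W(1) that, of r] rg that W by auto
  have fr: "frechet_derivative r (at y within V) = g' y" if "y \<in> W" for y
  proof -
    have "y \<in> interior V" using W that by auto
    then have "at y within V = at y" by (rule at_within_interior)
    then show ?thesis using frechet_derivative_at[OF dr[OF that]] by simp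
  qed
  define D2 where "D2 a v = frechet_derivative (\<lambda>y. g' y v) (at x0) a" for a v
  have dg2: "((\<lambda>y. g' y v) has_derivative (\<lambda>a. D2 a v)) (at x0)" for v
  proof -
    have "(\<lambda>y. g' y v) differentiable at x0"
      using g[of 2] U by (simp add: g'_def numeral_2_eq_2)
    then show ?thesis using frechet_derivative_works[of "\<lambda>y. g' y v" "at x0"]
      by (simp add: D2_def eta_contract_eq)
  qed
  have second: "second_derivative V r x0 a v = D2 a v" for a v
  proof -
    have "((\<lambda>y. frechet_derivative r (at y within V) v) has_derivative (\<lambda>a. D2 a v)) (at x0)"
      by (rule has_derivative_transform_within_open[OF dg2 W(1,2)]) (simp add: fr)
    moreover have "at x0 within V = at x0" using x0 by (rule at_within_interior)
    ultimately show ?thesis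
      unfolding second_derivative_def by (simp add: frechet_derivative_at[symmetric])
  qed
  define J where "J = g' x0"
  have J: "linear J" using dg[OF U(2)] unfolding J_def by (rule has_derivative_linear)
  have Jinj: "inj J" using inj fr[OF W(2)] by (simp add: J_def)
  have T: "tangent_space V r x0 = range J" by (simp add: tangent_space_def fr[OF W(2)] J_def)
  have subT: "subspace (range J)" using J linear_subspace_image subspace_UNIV by blast
  have bil: "bilinear D2"
  proof -
    have l2: "linear (D2 a)" for a
    proof (rule linearI)
      have lin: "linear (g' y)" if "y \<in> U" for y
        using dg[OF that] by (rule has_derivative_linear)
      show "D2 a (v + w) = D2 a v + D2 a w" for v w
      proof -
        have "((\<lambda>y. g' y (v + w)) has_derivative (\<lambda>a. D2 a v + D2 a w)) (at x0)"
          by (rule has_derivative_transform_within_open[OF has_derivative_add[OF dg2 dg2] U])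
             (simp add: linear_add[OF lin])
        from has_derivative_unique[OF this dg2] show ?thesis by (simp add: fun_eq_iff)
      qed
      show "D2 a (k *\<^sub>R v) = k *\<^sub>R D2 a v" for k v
      proof -
        have "((\<lambda>y. g' y (k *\<^sub>R v)) has_derivative (\<lambda>a. k *\<^sub>R D2 a v)) (at x0)"
          by (rule has_derivative_transform_within_open[OF has_derivative_scaleR_right[OF dg2] U])
             (simp add: linear_scale[OF lin])
        from has_derivative_unique[OF this dg2] show ?thesis by (simp add: fun_eq_iff)
      qed
    qed
    have "linear (\<lambda>a. D2 a v)" for v using dg2 by (rule has_derivative_linear)
    with l2 show ?thesis by (auto simp: bilinear_def)
  qed
  define n where "n = G (r x0)"
  have test: "n \<bullet> J v = 0" "D (J v) \<bullet> J v + n \<bullet> D2 v v \<le> 0" for v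
  proof -
    define l where "l t = x0 + t *\<^sub>R v" for t
    have dl: "(l has_derivative (\<lambda>t. t *\<^sub>R v)) (at t)" for t
      unfolding l_def by (auto intro!: derivative_eq_intros)
    have "open (l -` W)"
      unfolding l_def by (intro open_vimage W continuous_intros)
    moreover have "0 \<in> l -` W" using W by (simp add: l_def)
    ultimately obtain d where d: "d > 0" "\<And>t. \<bar>t\<bar> < d \<Longrightarrow> l t \<in> W"
      by (force simp: open_dist dist_real_def)
    define h where "h t = u (g (l t))" for t
    define h' where "h' t = G (g (l t)) \<bullet> g' (l t) v" for t
    have gl: "((\<lambda>t. g (l t)) has_derivative (\<lambda>s. g' (l t) (s *\<^sub>R v))) (at t)" if "\<bar>t\<bar> < d" for t
      using has_derivative_compose[OF dl, of g "g' (l t)" t] dg[of "l t"] d(2)[OF that] W by auto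
    have lin: "linear (g' (l t))" if "\<bar>t\<bar> < d" for t
      using dg[of "l t"] d(2)[OF that] W by (auto intro: has_derivative_linear)
    have "(h has_real_derivative h' t) (at t)" if t: "\<bar>t\<bar> < d" for t
    proof -
      have "(h has_derivative (\<lambda>s. G (g (l t)) \<bullet> g' (l t) (s *\<^sub>R v))) (at t)"
        unfolding h_def by (rule has_derivative_compose[OF gl[OF t] u])
      then show ?thesis
        unfolding has_field_derivative_def h'_def
        by (rule has_derivative_eq_rhs) (auto simp: linear_scale[OF lin[OF t]] fun_eq_iff)
    qed
    moreover have "(h' has_real_derivative (D (J v) \<bullet> J v + n \<bullet> D2 v v)) (at 0)"
    proof -
      have l0: "l 0 = x0" by (simp add: l_def)
      have 1: "((\<lambda>t. G (g (l t))) has_derivative (\<lambda>s. D (J (s *\<^sub>R v)))) (at 0)"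
        using has_derivative_compose[OF gl[of 0], of G D] d(1) G rg[OF W(2)]
        by (simp add: l0 J_def)
      have 2: "((\<lambda>t. g' (l t) v) has_derivative (\<lambda>s. D2 (s *\<^sub>R v) v)) (at 0)"
        using has_derivative_compose[OF dl, of "\<lambda>y. g' y v" "\<lambda>a. D2 a v" 0] dg2 by (simp add: l0)
      have linD: "linear D" using G by (rule has_derivative_linear)
      show ?thesis
        unfolding has_field_derivative_def h'_def
        by (rule has_derivative_eq_rhs[OF has_derivative_inner[OF 1 2]])
           (simp add: fun_eq_iff l0 J_def[symmetric] linear_scale[OF J] linear_scale[OF linD]
             bilinear_lmul[OF bil] n_def rg[OF W(2)] algebra_simps)
    qed
    moreover have "h t \<le> h 0" if "\<bar>t\<bar> < d" for t
      using N(3)[of "l t"] d(2)[OF that] W rg[OF d(2)[OF that]] rg[OF W(2)]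
      by (auto simp: h_def l_def)
    ultimately have "h' 0 = 0" "D (J v) \<bullet> J v + n \<bullet> D2 v v \<le> 0"
      using second_derivative_test_local_max[OF d(1), of h h' "D (J v) \<bullet> J v + n \<bullet> D2 v v"] by auto
    then show "n \<bullet> J v = 0" "D (J v) \<bullet> J v + n \<bullet> D2 v v \<le> 0"
      by (auto simp: h'_def n_def l_def J_def rg[OF W(2)])
  qed
  have normal: "n \<in> (range J)\<^sup>\<bottom>"
    using test(1) by (auto simp: orthogonal_comp_def orthogonal_def inner_commute)
  obtain B where B: "pairwise orthogonal B" "\<And>x. x \<in> B \<Longrightarrow> norm x = 1"
    "card B = dim (range J)" "span B = range J"
    using orthonormal_basis_subspace[OF subT] by metis
  have onB: "orthonormal B" using B by (simp add: orthonormal_def)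
  have "dim (range J) = CARD('n)"
    using dim_image_eq[OF J, of UNIV] Jinj by (simp add: dim_UNIV)
  moreover have "(\<Sum>\<tau>\<in>B. D \<tau> \<bullet> \<tau>) + G (r x0) \<bullet> e \<le> 0"
  proof -
    have JB: "J (inv J \<tau>) = \<tau>" if "\<tau> \<in> B" for \<tau>
      using that B(4) span_base[of \<tau> B] f_inv_into_f[of \<tau> J UNIV] by simp
    have bilQ: "bilinear (\<lambda>a b. n \<bullet> D2 a b)"
      using bil unfolding bilinear_def linear_iff by (simp add: inner_add_right)
    have metric: "induced_metric V r x0 = (\<chi> i j. J (axis i 1) \<bullet> J (axis j 1))"
      by (simp add: induced_metric_def fr[OF W(2)] J_def)
    have "n \<bullet> mean_curvature_vector V r x0 =
        (\<Sum>i\<in>UNIV. \<Sum>j\<in>UNIV. matrix_inv (\<chi> i j. J (axis i 1) \<bullet> J (axis j 1)) $ i $ j *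
            (n \<bullet> D2 (axis i 1) (axis j 1)))"
      unfolding mean_curvature_vector_def second_fundamental_form_def metric
      by (simp add: inner_sum_right T second normal_component_inner[OF subT normal])
    also have "\<dots> = (\<Sum>\<tau>\<in>B. n \<bullet> D2 (inv J \<tau>) (inv J \<tau>))"
      by (rule trace_inverse_gram[OF J Jinj onB B(4) bilQ])
    finally have mc: "n \<bullet> mean_curvature_vector V r x0 = \<dots>" .
    \<comment> \<open>If \<open>n\<close> is not zero, the translater equation is used with \<open>n\<close>, normalized, as the unit normal.\<close>
    have "n \<bullet> mean_curvature_vector V r x0 = n \<bullet> e"
    proof (cases "n = 0")
      case False
      define \<nu> where "\<nu> = n /\<^sub>R norm n"
      have "\<nu> \<in> (range J)\<^sup>\<bottom>"
        unfolding \<nu>_def using normal subspace_orthogonal_comp by (rule subspace_scale[rotated])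
      then have "mean_curvature_vector V r x0 = (e \<bullet> \<nu>) *\<^sub>R \<nu>"
        using H[of \<nu>] False T by (simp add: \<nu>_def)
      then show ?thesis using False
        by (simp add: \<nu>_def inner_commute dot_square_norm power2_eq_square field_simps)
    qed simp
    with mc have "n \<bullet> e = (\<Sum>\<tau>\<in>B. n \<bullet> D2 (inv J \<tau>) (inv J \<tau>))" by simp
    then have "(\<Sum>\<tau>\<in>B. D \<tau> \<bullet> \<tau>) + n \<bullet> e =
        (\<Sum>\<tau>\<in>B. D (J (inv J \<tau>)) \<bullet> J (inv J \<tau>) + n \<bullet> D2 (inv J \<tau>) (inv J \<tau>))"
      by (simp add: sum.distrib JB)
    also have "\<dots> \<le> 0" by (intro sum_nonpos test)
    finally show ?thesis by (simp add: n_def)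
  qed
  ultimately show ?thesis using that onB B(3) by simp
qed

lemma smooth_on_imp_continuous_on:
  assumes "smooth_on S f"
  shows "continuous_on S f"
  unfolding continuous_on_eq_continuous_within
proof
  fix x assume x: "x \<in> S"
  then obtain U g where U: "open U" "x \<in> U" and g: "continuously_differentiable_on 0 U g"
    and eq: "\<And>y. y \<in> S \<inter> U \<Longrightarrow> g y = f y"
    using assms unfolding smooth_on_def by metis
  have "(g \<longlongrightarrow> g x) (at x within S)"
    by (rule tendsto_within_subset[where S = UNIV])
       (use g U in \<open>simp_all add: continuous_on_eq_continuous_at continuous_at\<close>)
  moreover have "\<forall>\<^sub>F y in at x within S. g y = f y"
    using U eq by (auto simp: eventually_at_topological)
  ultimately have "(f \<longlongrightarrow> g x) (at x within S)" by (rule Lim_transform_eventually)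
  then show "continuous (at x within S) f" using eq[of x] x U by (simp add: continuous_within)
qed

lemma smooth_immersion_continuous_map:
  fixes A :: "('m, 'n::finite) chart set" and F :: "'m \<Rightarrow> 'b::euclidean_space"
  assumes X: "smooth_manifold_with_boundary X A" and F: "smooth_immersion A F"
  shows "continuous_map X euclidean F"
proof (rule pasting_lemma[where I = A and T = fst and f = "\<lambda>_. F"])
  fix c assume c: "c \<in> A"
  then have "is_chart X c" using X by (simp add: smooth_manifold_with_boundary_def)
  then show op: "openin X (fst c)" by (simp add: is_chart_def)
  have hom: "homeomorphic_map (subtopology X (fst c)) (top_of_set (chart_image c)) (snd c)"
    using \<open>is_chart X c\<close> by (simp add: is_chart_def)
  have top: "topspace (subtopology X (fst c)) = fst c"
    using op openin_subset by fastforce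
  have inj: "inj_on (snd c) (fst c)"
    using hom top by (simp add: homeomorphic_eq_everything_map)
  have "continuous_on (chart_image c) (F \<circ> chart_inv c)"
    by (rule smooth_on_imp_continuous_on) (use F c in \<open>simp add: smooth_immersion_def\<close>)
  then have "continuous_map (top_of_set (chart_image c)) euclidean (F \<circ> chart_inv c)" by simp
  with homeomorphic_imp_continuous_map[OF hom]
  have "continuous_map (subtopology X (fst c)) euclidean ((F \<circ> chart_inv c) \<circ> snd c)"
    by (rule continuous_map_compose)
  then show "continuous_map (subtopology X (fst c)) euclidean F"
    by (rule continuous_map_eq) (use inj top in simp)
next
  fix x assume "x \<in> topspace X"
  then show "\<exists>c. c \<in> A \<and> x \<in> fst c \<and> F x = F x"
    using X unfolding smooth_manifold_with_boundary_def by blast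
qed simp

lemma translater_local_max:
  fixes X :: "'m topology" and A :: "('m, 'n::finite) chart set"
    and F :: "'m \<Rightarrow> (real ^ 'n) \<times> real" and u :: "(real ^ 'n) \<times> real \<Rightarrow> real"
  assumes F: "self_translater X A F"
    and m: "m \<in> topspace X" "m \<notin> manifold_boundary A"
    and N: "openin X N" "m \<in> N" "\<And>x. x \<in> N \<Longrightarrow> u (F x) \<le> u (F m)"
    and u: "\<And>y. (u has_derivative (\<lambda>h. G y \<bullet> h)) (at y)"
    and G: "(G has_derivative D) (at (F m))"
  obtains B where "orthonormal B" "card B = CARD('n)"
    "(\<Sum>\<tau>\<in>B. D \<tau> \<bullet> \<tau>) + G (F m) \<bullet> (0, 1) \<le> 0"
proof -
  have X: "smooth_manifold_with_boundary X A" and im: "smooth_immersion A F"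
    and eq: "translater_equation A F"
    using F by (auto simp: self_translater_def)
  obtain c where c: "c \<in> A" "m \<in> fst c"
    using X m unfolding smooth_manifold_with_boundary_def by blast
  have ch: "is_chart X c" using X c by (simp add: smooth_manifold_with_boundary_def)
  have hom: "homeomorphic_map (subtopology X (fst c)) (top_of_set (chart_image c)) (snd c)"
    and op: "openin X (fst c)" using ch by (simp_all add: is_chart_def)
  have top: "topspace (subtopology X (fst c)) = fst c"
    using op openin_subset by fastforce
  have inj: "inj_on (snd c) (fst c)"
    using hom top by (simp add: homeomorphic_eq_everything_map)
  define V where "V = chart_image c"
  define r where "r = F \<circ> chart_inv c"
  have x0: "snd c m \<in> interior V" using m c by (auto simp: manifold_boundary_def V_def)
  have "snd c m \<in> V" using c by (simp add: V_def)
  have rm: "r (snd c x) = F x" if "x \<in> fst c" for x using that inj by (simp add: r_def)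
  have "openin (subtopology X (fst c)) (N \<inter> fst c)"
    using N(1) by (auto simp: openin_subtopology)
  then have "openin (top_of_set V) (snd c ` (N \<inter> fst c))"
    using hom unfolding homeomorphic_eq_everything_map open_map_def V_def by blast
  then obtain O' where O': "open O'" "snd c ` (N \<inter> fst c) = V \<inter> O'"
    by (auto simp: openin_open)
  have max: "u (r x) \<le> u (r (snd c m))" if "x \<in> interior V \<inter> O'" for x
  proof -
    have "x \<in> snd c ` (N \<inter> fst c)" using that O' interior_subset by blast
    then show ?thesis using N(3) rm c by auto
  qed
  have "m \<in> N \<inter> fst c" using N c by auto
  then have mO: "snd c m \<in> interior V \<inter> O'" using O' x0 by blast
  have sm: "smooth_on V r" and injd: "inj (frechet_derivative r (at (snd c m) within V))"
    using im c \<open>snd c m \<in> V\<close> by (auto simp: smooth_immersion_def V_def r_def)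
  have H: "mean_curvature_vector V r (snd c m) = ((0, 1) \<bullet> \<nu>) *\<^sub>R \<nu>"
    if "norm \<nu> = 1" "\<nu> \<in> (tangent_space V r (snd c m))\<^sup>\<bottom>" for \<nu>
    using eq c \<open>snd c m \<in> V\<close> that unfolding translater_equation_def V_def r_def by blast
  have "(G has_derivative D) (at (r (snd c m)))" using G rm c by simp
  moreover have "open (interior V \<inter> O')" using O' by auto
  ultimately obtain B where "orthonormal B" "card B = CARD('n)"
    "(\<Sum>\<tau>\<in>B. D \<tau> \<bullet> \<tau>) + G (r (snd c m)) \<bullet> (0, 1) \<le> 0"
    using parametrized_local_max[OF x0 sm injd H u _ _ mO max] by blast
  then show ?thesis using that rm[OF c(2)] by simp
qed

text \<open>The trace of a quadratic form over an unknown tangent hyperplane is its full trace minus its value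
  at the unit normal. This makes estimates possible that hold for all tangent planes at once.\<close>

lemma orthonormal_hyperplane_normal:
  fixes B :: "'a::euclidean_space set"
  assumes B: "orthonormal B" and card: "Suc (card B) = DIM('a)"
  obtains \<nu> where "norm \<nu> = 1" "\<And>w. (\<Sum>\<tau>\<in>B. (w \<bullet> \<tau>)\<^sup>2) = w \<bullet> w - (w \<bullet> \<nu>)\<^sup>2"
proof -
  have fin: "finite B" using B by (rule orthonormal_imp_finite)
  have "dim B \<le> card B" using fin by (rule dim_le_card')
  then have "dim B < DIM('a)" using card by linarith
  then obtain x where x: "x \<noteq> 0" "\<And>y. y \<in> span B \<Longrightarrow> orthogonal x y"
    using orthogonal_to_subspace_exists[of B] by blast
  define \<nu> where "\<nu> = x /\<^sub>R norm x"
  have n1: "norm \<nu> = 1" using x by (simp add: \<nu>_def)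
  have orth: "orthogonal \<nu> y" if "y \<in> B" for y
    using x(2)[OF span_base[OF that]] by (simp add: \<nu>_def orthogonal_def)
  have "\<nu> \<notin> B" using orth[of \<nu>] n1 by (auto simp: orthogonal_self)
  have on: "pairwise orthogonal (insert \<nu> B)"
    using B orth by (auto simp: orthonormal_def pairwise_insert orthogonal_def inner_commute)
  have "0 \<notin> insert \<nu> B" using n1 B by (auto simp: orthonormal_def)
  then have "independent (insert \<nu> B)" using on pairwise_orthogonal_independent by blast
  then have sp: "UNIV \<subseteq> span (insert \<nu> B)"
    by (intro card_ge_dim_independent) (use card fin \<open>\<nu> \<notin> B\<close> in \<open>auto simp: dim_UNIV\<close>)
  have "(\<Sum>\<tau>\<in>B. (w \<bullet> \<tau>)\<^sup>2) = w \<bullet> w - (w \<bullet> \<nu>)\<^sup>2" for w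
  proof -
    have "(\<Sum>\<tau>\<in>insert \<nu> B. (w \<bullet> \<tau>) *\<^sub>R \<tau>) = w"
      by (rule orthonormal_basis_expand) (use on n1 B fin sp in \<open>auto simp: orthonormal_def\<close>)
    then have "w \<bullet> w = w \<bullet> (\<Sum>\<tau>\<in>insert \<nu> B. (w \<bullet> \<tau>) *\<^sub>R \<tau>)" by simp
    also have "\<dots> = (\<Sum>\<tau>\<in>insert \<nu> B. (w \<bullet> \<tau>)\<^sup>2)"
      by (simp only: inner_sum_right inner_scaleR_right power2_eq_square)
    finally show ?thesis using fin \<open>\<nu> \<notin> B\<close> by simp
  qed
  with n1 show ?thesis using that by blast
qed

text \<open>The function \<open>w + exp (- w)\<close> replaces \<open>\<bar>w\<bar>\<close> as a measure of height differences: it tends to infinity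
  in both directions, and \<open>L\<close> of it is at most 1, because \<open>L\<close> of \<open>exp (- z)\<close> is not positive.\<close>

lemma exp_height_penalty_ge:
  fixes w :: real
  shows "\<bar>w\<bar> \<le> w + exp (- w)" "1 \<le> w + exp (- w)"
proof -
  show one: "1 \<le> w + exp (- w)" using exp_ge_add_one_self[of "- w"] by simp
  show "\<bar>w\<bar> \<le> w + exp (- w)"
  proof (cases "w \<ge> 0")
    case False
    have "1 - w/2 \<le> exp (- w/2)" using exp_ge_add_one_self[of "- w/2"] by simp
    then have "(1 - w/2)\<^sup>2 \<le> (exp (- w/2))\<^sup>2" using False by (intro power_mono) auto
    also have "\<dots> = exp (- w)" by (simp add: power2_eq_square exp_add[symmetric])
    finally have "(1 - w/2)\<^sup>2 \<le> exp (- w)" .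
    moreover have "(1 - w/2)\<^sup>2 = 1 - w + (w/2)\<^sup>2" "- 2 * w = 1 - w - (1 + w)"
      by (simp_all add: power2_eq_square algebra_simps)
    moreover have "(1 + w/2)\<^sup>2 = 1 + w + (w/2)\<^sup>2" by (simp add: power2_eq_square algebra_simps)
    moreover have "0 \<le> (1 + w/2)\<^sup>2" by simp
    ultimately show ?thesis using False by linarith
  qed simp
qed

section \<open>Comparison functions in a wedge\<close>

text \<open>The orthonormal vectors \<open>e1\<close> and \<open>e2\<close> span the plane in which the wedge lies: \<open>e1\<close> points inwards
  along its axis, and \<open>a\<close> shifts the origin so that the edge of the wedge has depth 0.\<close>

locale translater_in_wedge =
  fixes X :: "'m topology" and A :: "('m, 'n::finite) chart set"
    and F :: "'m \<Rightarrow> (real ^ 'n) \<times> real"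
    and e1 e2 :: "real ^ 'n" and a \<kappa> :: real
  assumes translater: "self_translater X A F"
    and proper: "proper_map X euclidean F"
    and compact_boundary: "compactin X (manifold_boundary A)"
    and frame: "norm e1 = 1" "norm e2 = 1" "e1 \<bullet> e2 = 0"
    and wedge: "\<And>x. x \<in> topspace X \<Longrightarrow> \<bar>e2 \<bullet> fst (F x)\<bar> \<le> \<kappa> * (e1 \<bullet> fst (F x) + a)"
    and slope: "\<kappa> > 0"
begin

abbreviation depth :: "(real ^ 'n) \<times> real \<Rightarrow> real" where
  "depth y \<equiv> e1 \<bullet> fst y + a"

abbreviation lateral :: "(real ^ 'n) \<times> real \<Rightarrow> real" where
  "lateral y \<equiv> e2 \<bullet> fst y"

text \<open>All comparison functions of the proof have this form: a quadratic polynomial in the plane of the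
  wedge, a penalty for the horizontal distance from \<open>q\<close>, and a function of the height.\<close>

definition barrier ::
  "real \<Rightarrow> real \<Rightarrow> real \<Rightarrow> real \<Rightarrow> real ^ 'n \<Rightarrow> (real \<Rightarrow> real) \<Rightarrow> (real ^ 'n) \<times> real \<Rightarrow> real" where
  "barrier \<alpha> \<beta> \<mu> \<delta> q \<phi> y =
     \<alpha> * (depth y)\<^sup>2 + \<beta> * (lateral y)\<^sup>2 + \<mu> * depth y - \<delta> * ((fst y - q) \<bullet> (fst y - q)) + \<phi> (snd y)"

lemma continuous_F: "continuous_map X euclidean F"
  using translater smooth_immersion_continuous_map by (auto simp: self_translater_def)

lemma depth_nonneg: "0 \<le> depth (F x)" if "x \<in> topspace X"
proof -
  have "0 \<le> \<kappa> * depth (F x)" using wedge[OF that] abs_ge_zero order_trans by blast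
  then show ?thesis using slope by (simp add: zero_le_mult_iff)
qed

lemma barrier_derivative:
  assumes "\<And>w. (\<phi> has_real_derivative \<phi>' w) (at w)"
  shows "(barrier \<alpha> \<beta> \<mu> \<delta> q \<phi> has_derivative
     (\<lambda>h. ((2 * \<alpha> * depth y) *\<^sub>R e1 + (2 * \<beta> * lateral y) *\<^sub>R e2 + \<mu> *\<^sub>R e1
             - (2 * \<delta>) *\<^sub>R (fst y - q), \<phi>' (snd y)) \<bullet> h)) (at y)"
proof -
  have \<phi>: "((\<lambda>y. \<phi> (snd y)) has_derivative (\<lambda>h. \<phi>' (snd y) * snd h)) (at y)"
    using assms[of "snd y"] unfolding has_field_derivative_def
    by (rule has_derivative_compose[rotated, where f = snd]) (auto intro!: derivative_eq_intros)
  show ?thesis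
    unfolding barrier_def[abs_def]
    by (rule derivative_eq_intros \<phi> refl)+
       (auto simp: fun_eq_iff inner_prod_def inner_add_left inner_diff_left inner_commute
          algebra_simps)
qed

lemma gradient_derivative:
  assumes "(\<phi>' has_real_derivative c) (at (snd y))"
  shows "((\<lambda>y. ((2 * \<alpha> * depth y) *\<^sub>R e1 + (2 * \<beta> * lateral y) *\<^sub>R e2 + \<mu> *\<^sub>R e1
             - (2 * \<delta>) *\<^sub>R (fst y - q), \<phi>' (snd y))) has_derivative
     (\<lambda>h. ((2 * \<alpha> * (e1 \<bullet> fst h)) *\<^sub>R e1 + (2 * \<beta> * (e2 \<bullet> fst h)) *\<^sub>R e2
             - (2 * \<delta>) *\<^sub>R fst h, c * snd h))) (at y)"
proof -
  have \<phi>: "((\<lambda>y. \<phi>' (snd y)) has_derivative (\<lambda>h. c * snd h)) (at y)"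
    using assms unfolding has_field_derivative_def
    by (rule has_derivative_compose[rotated, where f = snd]) (auto intro!: derivative_eq_intros)
  show ?thesis
    by (rule derivative_eq_intros \<phi> refl)+ (auto simp: fun_eq_iff)
qed

text \<open>The expression in the assumption \<open>strict\<close> is \<open>L\<close> of the barrier for a tangent plane with unit normal
  \<open>(h, z)\<close> at height \<open>w\<close>. As it is positive for every such plane, a maximum over the part of depth at
  most \<open>b\<close> is taken at depth \<open>b\<close> or on the boundary of the surface. A maximum exists
  because the surface is proper and the superlevel set is bounded.\<close>

lemma barrier_principle:
  assumes \<phi>: "\<And>w. (\<phi> has_real_derivative \<phi>' w) (at w)"
    and \<phi>': "\<And>w. (\<phi>' has_real_derivative \<phi>'' w) (at w)"
    and strict: "\<And>(h::real ^ 'n) z w. h \<bullet> h + z\<^sup>2 = 1 \<Longrightarrow>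
       0 < 2 * \<alpha> * (1 - (e1 \<bullet> h)\<^sup>2) + 2 * \<beta> * (1 - (e2 \<bullet> h)\<^sup>2)
           - 2 * \<delta> * (real CARD('n) - 1 + z\<^sup>2) + \<phi>'' w * (1 - z\<^sup>2) + \<phi>' w"
    and p: "p \<in> topspace X" "depth (F p) \<le> b"
    and bdd: "bounded {y \<in> F ` topspace X. depth y \<le> b \<and>
       barrier \<alpha> \<beta> \<mu> \<delta> q \<phi> (F p) \<le> barrier \<alpha> \<beta> \<mu> \<delta> q \<phi> y}"
  obtains m where "m \<in> topspace X" "depth (F m) \<le> b"
    "barrier \<alpha> \<beta> \<mu> \<delta> q \<phi> (F p) \<le> barrier \<alpha> \<beta> \<mu> \<delta> q \<phi> (F m)"
    "m \<in> manifold_boundary A \<or> depth (F m) = b"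
proof -
  define u where "u = barrier \<alpha> \<beta> \<mu> \<delta> q \<phi>"
  have du: "(u has_derivative
     (\<lambda>h. ((2 * \<alpha> * depth y) *\<^sub>R e1 + (2 * \<beta> * lateral y) *\<^sub>R e2 + \<mu> *\<^sub>R e1
             - (2 * \<delta>) *\<^sub>R (fst y - q), \<phi>' (snd y)) \<bullet> h)) (at y)" for y
    unfolding u_def by (rule barrier_derivative[OF \<phi>])
  have cont: "continuous_on UNIV u"
    by (intro continuous_at_imp_continuous_on ballI has_derivative_continuous[OF du])
  obtain R where "\<forall>y\<in>{y \<in> F ` topspace X. depth y \<le> b \<and> u (F p) \<le> u y}. norm y \<le> R"
    using bdd unfolding bounded_iff u_def by blast
  then have R: "norm y \<le> R" if "y \<in> F ` topspace X" "depth y \<le> b" "u (F p) \<le> u y" for y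
    using that by blast
  define K where "K = cball 0 R \<inter> {y. depth y \<le> b} \<inter> {y. u (F p) \<le> u y}"
  have "closed {y. depth y \<le> b}" "closed {y. u (F p) \<le> u y}"
    by (intro closed_Collect_le continuous_intros cont)+
  then have "compact K" unfolding K_def by (intro compact_Int_closed compact_cball)
  then have "compactin X {x \<in> topspace X. F x \<in> K}"
    using compactin_proper_map_preimage[OF proper, of K] by simp
  moreover have "continuous_map X euclidean (u \<circ> F)"
    using continuous_F cont by (intro continuous_map_compose[where X' = euclidean]) auto
  ultimately have "compactin euclidean ((u \<circ> F) ` {x \<in> topspace X. F x \<in> K})"
    by (rule image_compactin)
  then have cpt: "compact ((u \<circ> F) ` {x \<in> topspace X. F x \<in> K})" by simp
  have pK: "p \<in> {x \<in> topspace X. F x \<in> K}" using p R by (auto simp: K_def)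
  obtain m where m: "m \<in> topspace X" "F m \<in> K"
    and max: "\<And>x. x \<in> topspace X \<Longrightarrow> F x \<in> K \<Longrightarrow> u (F x) \<le> u (F m)"
    using compact_attains_sup[OF cpt] pK by auto
  have up: "u (F p) \<le> u (F m)" using max pK by auto
  have "m \<in> manifold_boundary A \<or> depth (F m) = b"
  proof (rule ccontr)
    assume neg: "\<not> ?thesis"
    define N where "N = {x \<in> topspace X. F x \<in> {y. depth y < b}}"
    have "open {y. depth y < b}" by (intro open_Collect_less continuous_intros)
    then have "openin X N"
      unfolding N_def using continuous_F by (intro openin_continuous_map_preimage) auto
    moreover have "m \<in> N" using m neg by (auto simp: N_def K_def)
    moreover have "u (F x) \<le> u (F m)" if "x \<in> N" for x
    proof (cases "u (F p) \<le> u (F x)")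
      case True
      then show ?thesis using that R by (intro max) (auto simp: N_def K_def)
    qed (use up in simp)
    ultimately obtain B where B: "orthonormal B" "card B = CARD('n)" and
      sum: "(\<Sum>\<tau>\<in>B. ((2 * \<alpha> * (e1 \<bullet> fst \<tau>)) *\<^sub>R e1 + (2 * \<beta> * (e2 \<bullet> fst \<tau>)) *\<^sub>R e2
             - (2 * \<delta>) *\<^sub>R fst \<tau>, \<phi>'' (snd (F m)) * snd \<tau>) \<bullet> \<tau>)
         + ((2 * \<alpha> * depth (F m)) *\<^sub>R e1 + (2 * \<beta> * lateral (F m)) *\<^sub>R e2 + \<mu> *\<^sub>R e1
             - (2 * \<delta>) *\<^sub>R (fst (F m) - q), \<phi>' (snd (F m))) \<bullet> (0, 1) \<le> 0"
      using translater_local_max[OF translater m(1) _ _ _ _ du gradient_derivative[OF \<phi>'], of N] neg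
      by blast
    obtain \<nu> where \<nu>: "norm \<nu> = 1" "\<And>w. (\<Sum>\<tau>\<in>B. (w \<bullet> \<tau>)\<^sup>2) = w \<bullet> w - (w \<bullet> \<nu>)\<^sup>2"
      using orthonormal_hyperplane_normal[OF B(1)] B(2) by auto
    have fin: "finite B" using B(1) by (rule orthonormal_imp_finite)
    have s1: "(\<Sum>\<tau>\<in>B. (e1 \<bullet> fst \<tau>)\<^sup>2) = 1 - (e1 \<bullet> fst \<nu>)\<^sup>2"
      using \<nu>(2)[of "(e1, 0)"] frame by (simp add: inner_prod_def dot_square_norm)
    have s2: "(\<Sum>\<tau>\<in>B. (e2 \<bullet> fst \<tau>)\<^sup>2) = 1 - (e2 \<bullet> fst \<nu>)\<^sup>2"
      using \<nu>(2)[of "(e2, 0)"] frame by (simp add: inner_prod_def dot_square_norm)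
    have s3: "(\<Sum>\<tau>\<in>B. (snd \<tau>)\<^sup>2) = 1 - (snd \<nu>)\<^sup>2"
      using \<nu>(2)[of "(0, 1)"] by (simp add: inner_prod_def)
    have "fst \<tau> \<bullet> fst \<tau> = 1 - (snd \<tau>)\<^sup>2" if "\<tau> \<in> B" for \<tau>
    proof -
      have "\<tau> \<bullet> \<tau> = 1" using B(1) that by (simp add: orthonormal_def dot_square_norm)
      then show ?thesis by (simp add: inner_prod_def power2_eq_square)
    qed
    then have "(\<Sum>\<tau>\<in>B. fst \<tau> \<bullet> fst \<tau>) = (\<Sum>\<tau>\<in>B. 1 - (snd \<tau>)\<^sup>2)" by (intro sum.cong) auto
    then have s4: "(\<Sum>\<tau>\<in>B. fst \<tau> \<bullet> fst \<tau>) = real CARD('n) - 1 + (snd \<nu>)\<^sup>2"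
      using s3 B(2) by (simp add: sum_subtractf)
    have "(\<Sum>\<tau>\<in>B. ((2 * \<alpha> * (e1 \<bullet> fst \<tau>)) *\<^sub>R e1 + (2 * \<beta> * (e2 \<bullet> fst \<tau>)) *\<^sub>R e2
             - (2 * \<delta>) *\<^sub>R fst \<tau>, \<phi>'' (snd (F m)) * snd \<tau>) \<bullet> \<tau>) =
        2 * \<alpha> * (\<Sum>\<tau>\<in>B. (e1 \<bullet> fst \<tau>)\<^sup>2) + 2 * \<beta> * (\<Sum>\<tau>\<in>B. (e2 \<bullet> fst \<tau>)\<^sup>2)
         - 2 * \<delta> * (\<Sum>\<tau>\<in>B. fst \<tau> \<bullet> fst \<tau>) + \<phi>'' (snd (F m)) * (\<Sum>\<tau>\<in>B. (snd \<tau>)\<^sup>2)"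
      by (simp add: inner_prod_def inner_add_left inner_diff_left sum.distrib sum_subtractf
          sum_distrib_left power2_eq_square mult_ac)
    then have "2 * \<alpha> * (1 - (e1 \<bullet> fst \<nu>)\<^sup>2) + 2 * \<beta> * (1 - (e2 \<bullet> fst \<nu>)\<^sup>2)
           - 2 * \<delta> * (real CARD('n) - 1 + (snd \<nu>)\<^sup>2) + \<phi>'' (snd (F m)) * (1 - (snd \<nu>)\<^sup>2)
           + \<phi>' (snd (F m)) \<le> 0"
      using sum unfolding s1 s2 s3 s4 by (simp add: inner_prod_def)
    moreover have "\<nu> \<bullet> \<nu> = 1" using \<nu>(1) by (simp add: dot_square_norm)
    then have "fst \<nu> \<bullet> fst \<nu> + (snd \<nu>)\<^sup>2 = 1" by (simp add: inner_prod_def power2_eq_square)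
    ultimately show False using strict[of "fst \<nu>" "snd \<nu>" "snd (F m)"] by linarith
  qed
  then show ?thesis using that m up unfolding u_def K_def by blast
qed

section \<open>Translaters in a wedge are compact\<close>

lemma boundary_in_topspace: "manifold_boundary A \<subseteq> topspace X"
  using compact_boundary by (rule compactin_subset_topspace)

lemma boundary_norm_bound: obtains R where "\<And>m. m \<in> manifold_boundary A \<Longrightarrow> norm (F m) \<le> R"
proof -
  have "compactin euclidean (F ` manifold_boundary A)"
    using compact_boundary continuous_F by (rule image_compactin)
  then have "bounded (F ` manifold_boundary A)" by (simp add: compact_imp_bounded)
  then obtain R where "\<forall>y\<in>F ` manifold_boundary A. norm y \<le> R" unfolding bounded_iff by blast
  then show ?thesis using that by blast
qed

text \<open>A smooth substitute for the distance from \<open>p\<close>, with \<open>L\<close> of it at most \<open>2 n + 1\<close>; the squared distance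
  itself would not do, as the drift makes \<open>L\<close> of it unbounded above.\<close>

definition escape :: "(real ^ 'n) \<times> real \<Rightarrow> (real ^ 'n) \<times> real \<Rightarrow> real" where
  "escape y p = (fst y - fst p) \<bullet> (fst y - fst p) + ((snd y - snd p) + exp (- (snd y - snd p)))"

lemma escape_ge: "norm (y - p) \<le> escape y p + 1" "1 \<le> escape y p"
proof -
  define h where "h = norm (fst y - fst p)"
  have e: "escape y p = h\<^sup>2 + ((snd y - snd p) + exp (- (snd y - snd p)))"
    by (simp add: escape_def h_def dot_square_norm)
  have "norm (y - p) \<le> h + \<bar>snd y - snd p\<bar>"
  proof -
    have "y - p = (fst y - fst p, snd y - snd p)" by (simp add: prod_eq_iff)
    then show ?thesis
      using norm_Pair_le[of "fst y - fst p" "snd y - snd p"] unfolding h_def real_norm_def by metis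
  qed
  moreover have "h \<le> h\<^sup>2 + 1"
  proof -
    have "0 \<le> (h - 1)\<^sup>2 + h\<^sup>2 + 1" by simp
    then show ?thesis by (simp add: power2_eq_square algebra_simps)
  qed
  ultimately show "norm (y - p) \<le> escape y p + 1"
    using exp_height_penalty_ge(1)[of "snd y - snd p"] e by linarith
  show "1 \<le> escape y p" using exp_height_penalty_ge(2)[of "snd y - snd p"] e
    by (smt (verit) zero_le_power2)
qed

lemma bessel_frame: "(e1 \<bullet> h)\<^sup>2 + (e2 \<bullet> h)\<^sup>2 \<le> h \<bullet> h"
proof -
  define w where "w = h - (e1 \<bullet> h) *\<^sub>R e1 - (e2 \<bullet> h) *\<^sub>R e2"
  have "e1 \<bullet> e1 = 1" "e2 \<bullet> e2 = 1" "e2 \<bullet> e1 = 0"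
    using frame by (simp_all add: dot_square_norm inner_commute)
  then have "w \<bullet> w = h \<bullet> h - (e1 \<bullet> h)\<^sup>2 - (e2 \<bullet> h)\<^sup>2"
    using frame by (simp add: w_def inner_diff_left inner_diff_right inner_commute
        power2_eq_square algebra_simps)
  then show ?thesis using inner_ge_zero[of w] by linarith
qed

text \<open>The comparison function is \<open>s\<^sup>2 + t\<^sup>2 - 2 M s - c escape\<close>, centred at the point \<open>p\<close> that is to be
  bounded and considered where \<open>s \<le> l\<close>. Geometrically \<open>s\<^sup>2 + t\<^sup>2 - 2 M s\<close> is, up to a constant, the
  squared distance from a far away point of the axis. For a wedge of angle less than \<open>\<pi>\<close> the cut
  \<open>s = l\<close> is closer to that point than the part \<open>s \<le> b\<close> is, so the maximum, being at least the
  value at \<open>p\<close>, is on the boundary of the surface. There the penalty must be bounded by a constant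
  that does not depend on \<open>p\<close>.\<close>

lemma depth_sublevel_bounded:
  assumes "0 \<le> b"
  obtains R where "\<And>p. p \<in> topspace X \<Longrightarrow> depth (F p) \<le> b \<Longrightarrow> norm (F p) \<le> R"
proof -
  obtain R where R: "\<And>m. m \<in> manifold_boundary A \<Longrightarrow> norm (F m) \<le> R"
    using boundary_norm_bound by blast
  \<comment> \<open>\<open>L\<close> of the quadratic part is at least 2, and \<open>c\<close> times the bound \<open>2 n + 1\<close> for the penalty is 1.
    The constant \<open>M\<close> bounds \<open>s\<^sup>2 + t\<^sup>2\<close> where \<open>s \<le> l\<close> and is large enough for the comparison at the cut,
    since \<open>2 M (l - b)\<close> is at least \<open>2 M\<close>.\<close>
  define c where "c = 1 / (2 * real CARD('n) + 1)"
  define l where "l = 2 * b + 1"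
  define M where "M = (1 + \<kappa>\<^sup>2) * l\<^sup>2"
  have c: "0 < c" "c * (2 * real CARD('n) + 1) = 1" by (simp_all add: c_def)
  have l: "l \<ge> 1" "b < l" using assms by (simp_all add: l_def)
  have M: "M > 0" using l by (simp add: M_def add_pos_nonneg)
  have plane: "(depth (F x))\<^sup>2 + (lateral (F x))\<^sup>2 \<le> M"
    if "x \<in> topspace X" "depth (F x) \<le> l" for x
  proof -
    have d: "(depth (F x))\<^sup>2 \<le> l\<^sup>2" using depth_nonneg[OF that(1)] that(2) by (intro power_mono)
    have "(lateral (F x))\<^sup>2 \<le> (\<kappa> * depth (F x))\<^sup>2"
      using power_mono[OF wedge[OF that(1)], of 2] by simp
    also have "\<dots> \<le> \<kappa>\<^sup>2 * l\<^sup>2" using d by (simp add: power_mult_distrib mult_left_mono)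
    finally show ?thesis using d by (simp add: M_def algebra_simps)
  qed
  show ?thesis
  proof (rule that)
    fix p assume p: "p \<in> topspace X" "depth (F p) \<le> b"
    define q z where "q = fst (F p)" and "z = snd (F p)"
    define \<phi> where "\<phi> w = - c * ((w - z) + exp (- (w - z)))" for w
    define \<phi>' where "\<phi>' w = - c * (1 - exp (- (w - z)))" for w
    define \<phi>'' where "\<phi>'' w = - c * exp (- (w - z))" for w
    have d\<phi>: "(\<phi> has_real_derivative \<phi>' w) (at w)" "(\<phi>' has_real_derivative \<phi>'' w) (at w)" for w
      unfolding \<phi>_def[abs_def] \<phi>'_def[abs_def] \<phi>''_def
      by (auto intro!: derivative_eq_intros simp: algebra_simps)
    define u where "u = barrier 1 1 (- 2 * M) c q \<phi>"
    have u: "u y = (depth y)\<^sup>2 + (lateral y)\<^sup>2 - 2 * M * depth y - c * escape y (F p)" for y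
      by (simp add: u_def barrier_def escape_def \<phi>_def q_def z_def algebra_simps)
    have strict: "0 < 2 * 1 * (1 - (e1 \<bullet> h)\<^sup>2) + 2 * 1 * (1 - (e2 \<bullet> h)\<^sup>2)
           - 2 * c * (real CARD('n) - 1 + s\<^sup>2) + \<phi>'' w * (1 - s\<^sup>2) + \<phi>' w"
      if hs: "h \<bullet> h + s\<^sup>2 = 1" for h :: "real ^ 'n" and s w
    proof -
      have s: "s\<^sup>2 \<le> 1" using hs inner_ge_zero[of h] by linarith
      have "(e1 \<bullet> h)\<^sup>2 + (e2 \<bullet> h)\<^sup>2 \<le> 1" using bessel_frame[of h] hs by (smt (verit) zero_le_power2)
      moreover have "c * (real CARD('n) - 1 + s\<^sup>2) \<le> c * real CARD('n)" using s c by simp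
      moreover have "\<phi>'' w * (1 - s\<^sup>2) + \<phi>' w = - c + c * exp (- (w - z)) * s\<^sup>2"
        by (simp add: \<phi>''_def \<phi>'_def algebra_simps)
      moreover have "0 \<le> c * exp (- (w - z)) * s\<^sup>2" using c by simp
      moreover have "2 * (c * real CARD('n)) + c = 1" using c(2) by (simp add: algebra_simps)
      ultimately show ?thesis by (simp add: algebra_simps)
    qed
    have "depth (F p) \<le> l" using p l by simp
    have "bounded {y \<in> F ` topspace X. depth y \<le> l \<and> u (F p) \<le> u y}"
      unfolding bounded_iff
    proof (intro exI ballI)
      fix y assume "y \<in> {y \<in> F ` topspace X. depth y \<le> l \<and> u (F p) \<le> u y}"
      then obtain x where x: "x \<in> topspace X" "y = F x" "depth y \<le> l" "u (F p) \<le> u y" by blast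
      have "0 \<le> 2 * M * depth y" using M depth_nonneg[OF x(1)] x(2) by simp
      then have "c * escape y (F p) \<le> M - u (F p)" using x u[of y] plane[OF x(1)] by simp
      then have "escape y (F p) \<le> (M - u (F p)) / c" using c by (simp add: field_simps)
      then have "norm (y - F p) \<le> (M - u (F p)) / c + 1" using escape_ge(1)[of y "F p"] by linarith
      then show "norm y \<le> norm (F p) + ((M - u (F p)) / c + 1)"
        using norm_triangle_sub[of y "F p"] by linarith
    qed
    then obtain m where m: "m \<in> topspace X" "depth (F m) \<le> l" "u (F p) \<le> u (F m)"
      and side: "m \<in> manifold_boundary A \<or> depth (F m) = l"
      using barrier_principle[OF d\<phi> strict p(1) \<open>depth (F p) \<le> l\<close>, where q = q and \<mu> = "- 2 * M"]
      unfolding u_def by blast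
    have "escape (F p) (F p) = 1" by (simp add: escape_def)
    then have "- 2 * M * depth (F p) - c \<le> u (F p)" using u[of "F p"] by simp
    moreover have "2 * M * depth (F p) \<le> 2 * M * b" using p M by simp
    ultimately have up: "- 2 * M * b - c \<le> u (F m)" using m by simp
    have um: "u (F m) \<le> M - 2 * M * depth (F m) - c * escape (F m) (F p)"
      using u[of "F m"] plane[OF m(1,2)] by simp
    from side have mb: "m \<in> manifold_boundary A"
    proof
      assume "depth (F m) = l"
      moreover have "c * 1 \<le> c * escape (F m) (F p)" using c escape_ge(2) by (intro mult_left_mono) auto
      ultimately have "- 2 * M * b \<le> M - 2 * M * l" using up um by simp
      moreover have "2 * M * b + 2 * M = 2 * M * l - 2 * M * b" by (simp add: l_def algebra_simps)
      moreover have "0 \<le> M * b" using M assms by simp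
      ultimately show ?thesis using M by (simp add: algebra_simps)
    qed
    have "0 \<le> 2 * M * depth (F m)" using M depth_nonneg[OF m(1)] by simp
    then have "c * escape (F m) (F p) \<le> M + 2 * M * b + c" using up um by simp
    then have "escape (F m) (F p) \<le> (M + 2 * M * b + c) / c" using c by (simp add: field_simps)
    then have "norm (F m - F p) \<le> (M + 2 * M * b + c) / c + 1"
      using escape_ge(1)[of "F m" "F p"] by linarith
    then show "norm (F p) \<le> R + ((M + 2 * M * b + c) / c + 1)"
      using R[OF mb] norm_triangle_sub[of "F p" "F m"] by (simp add: norm_minus_commute)
  qed
qed

lemma depth_sublevel_subset_bounded:
  "bounded {y \<in> F ` topspace X. depth y \<le> b \<and> P y}"
proof -
  obtain R where R: "\<And>p. p \<in> topspace X \<Longrightarrow> depth (F p) \<le> max b 0 \<Longrightarrow> norm (F p) \<le> R"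
    by (rule depth_sublevel_bounded[of "max b 0"]) auto
  have "\<forall>y\<in>{y \<in> F ` topspace X. depth y \<le> b \<and> P y}. norm y \<le> R"
  proof
    fix y assume "y \<in> {y \<in> F ` topspace X. depth y \<le> b \<and> P y}"
    then obtain x where "x \<in> topspace X" "y = F x" "depth (F x) \<le> b" by blast
    then show "norm y \<le> R" using R[of x] by simp
  qed
  then show ?thesis unfolding bounded_iff by blast
qed

text \<open>The function \<open>- exp (- z / 2)\<close> is strictly subsolutional and bounded above by 0, so
  on a cut \<open>s = b\<close> with large \<open>b\<close> the function \<open>- exp (- z / 2) - \<epsilon> s\<close> does not exceed its bound
  \<open>- exp (- Z / 2)\<close> on the boundary. Let \<open>\<epsilon>\<close> tend to 0.
  The halved exponent is what makes it strict: for \<open>- exp (- z)\<close>, \<open>L\<close> vanishes at vertical tangent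
  planes.\<close>

lemma height_le_boundary_height:
  assumes Z: "\<And>m. m \<in> manifold_boundary A \<Longrightarrow> snd (F m) \<le> Z" and p: "p \<in> topspace X"
  shows "snd (F p) \<le> Z"
proof -
  have "exp (- Z / 2) \<le> exp (- snd (F p) / 2) + \<epsilon> * depth (F p)" if \<epsilon>: "\<epsilon> > 0" for \<epsilon>
  proof -
    \<comment> \<open>From depth \<open>exp (- Z / 2) / \<epsilon>\<close> on, the term \<open>- \<epsilon> s\<close> alone is at most the bound at the boundary.\<close>
    define b where "b = max (depth (F p)) (exp (- Z / 2) / \<epsilon>)"
    define \<phi> where "\<phi> w = - exp (- w / 2)" for w :: real
    define \<phi>' where "\<phi>' w = exp (- w / 2) / 2" for w :: real
    define \<phi>'' where "\<phi>'' w = - exp (- w / 2) / 4" for w :: real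
    have d\<phi>: "(\<phi> has_real_derivative \<phi>' w) (at w)" "(\<phi>' has_real_derivative \<phi>'' w) (at w)" for w
      unfolding \<phi>_def[abs_def] \<phi>'_def[abs_def] \<phi>''_def
      by (auto intro!: derivative_eq_intros)
    have strict: "0 < 2 * 0 * (1 - (e1 \<bullet> h)\<^sup>2) + 2 * 0 * (1 - (e2 \<bullet> h)\<^sup>2)
           - 2 * 0 * (real CARD('n) - 1 + s\<^sup>2) + \<phi>'' w * (1 - s\<^sup>2) + \<phi>' w"
      if "h \<bullet> h + s\<^sup>2 = 1" for h :: "real ^ 'n" and s w
    proof -
      have "\<phi>'' w * (1 - s\<^sup>2) + \<phi>' w = exp (- w / 2) * (1 + s\<^sup>2) / 4"
        by (simp add: \<phi>''_def \<phi>'_def field_simps)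
      moreover have "0 < exp (- w / 2) * (1 + s\<^sup>2) / 4" by (simp add: add_pos_nonneg)
      ultimately show ?thesis by simp
    qed
    have u: "barrier 0 0 (- \<epsilon>) 0 0 \<phi> y = - exp (- snd y / 2) - \<epsilon> * depth y" for y
      by (simp add: barrier_def \<phi>_def)
    have "depth (F p) \<le> b" by (simp add: b_def)
    then obtain m where m: "m \<in> topspace X"
      "barrier 0 0 (- \<epsilon>) 0 0 \<phi> (F p) \<le> barrier 0 0 (- \<epsilon>) 0 0 \<phi> (F m)"
      "m \<in> manifold_boundary A \<or> depth (F m) = b"
      using barrier_principle[OF d\<phi> strict p _ depth_sublevel_subset_bounded] by blast
    have "barrier 0 0 (- \<epsilon>) 0 0 \<phi> (F m) \<le> - exp (- Z / 2)"
      using m(3)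
    proof
      assume "m \<in> manifold_boundary A"
      then have "exp (- Z / 2) \<le> exp (- snd (F m) / 2)" using Z by simp
      moreover have "0 \<le> \<epsilon> * depth (F m)" using depth_nonneg[OF m(1)] \<epsilon> by simp
      ultimately show ?thesis by (simp only: u)
    next
      assume side: "depth (F m) = b"
      have "exp (- Z / 2) / \<epsilon> \<le> b" by (simp add: b_def)
      then have "exp (- Z / 2) \<le> \<epsilon> * b" using \<epsilon> by (simp add: field_simps)
      moreover have "0 < exp (- snd (F m) / 2)" by simp
      ultimately show ?thesis unfolding u side by linarith
    qed
    then show ?thesis using m(2) unfolding u by linarith
  qed
  then have "exp (- Z / 2) \<le> exp (- snd (F p) / 2) + e" if "e > 0" for e
  proof (cases "depth (F p) = 0")
    case False
    then have "depth (F p) > 0" using depth_nonneg[OF p] by simp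
    then show ?thesis
      using \<open>\<And>\<epsilon>. 0 < \<epsilon> \<Longrightarrow> exp (- Z / 2) \<le> exp (- snd (F p) / 2) + \<epsilon> * depth (F p)\<close>[of "e / depth (F p)"]
        that by simp
  next
    case True
    then show ?thesis
      using \<open>\<And>\<epsilon>. 0 < \<epsilon> \<Longrightarrow> exp (- Z / 2) \<le> exp (- snd (F p) / 2) + \<epsilon> * depth (F p)\<close>[of 1, unfolded True]
        that by linarith
  qed
  then have "exp (- Z / 2) \<le> exp (- snd (F p) / 2)" by (rule field_le_epsilon)
  then show ?thesis by simp
qed

text \<open>The height function along the surface is as convex in the depth as \<open>s\<^sup>2 / 2\<close>, because \<open>L z = 1\<close> while
  \<open>L (s\<^sup>2 / 2) \<le> 1\<close>; this is incompatible with an upper bound for the height at arbitrarily large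
  depth. In the comparison function \<open>z - s\<^sup>2 / 4 + b s / 4\<close> the factor 1/4 leaves a strict inequality, and
  the linear term cancels the quadratic one on the cut \<open>s = b\<close>.\<close>

lemma depth_le_boundary_depth:
  assumes S: "0 \<le> S" "\<And>m. m \<in> manifold_boundary A \<Longrightarrow> depth (F m) \<le> S"
    and p: "p \<in> topspace X"
  shows "depth (F p) \<le> S"
proof (rule ccontr)
  assume neg: "\<not> depth (F p) \<le> S"
  obtain R where "\<And>m. m \<in> manifold_boundary A \<Longrightarrow> norm (F m) \<le> R"
    using boundary_norm_bound by blast
  moreover have "snd (F m) \<le> norm (F m)" for m
    using norm_snd_le[of "snd (F m)" "fst (F m)"] by simp
  ultimately have "snd (F m) \<le> R" if "m \<in> manifold_boundary A" for m
    using that order_trans by blast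
  then have Z: "snd (F x) \<le> R" if "x \<in> topspace X" for x
    using height_le_boundary_height that by blast
  \<comment> \<open>With this \<open>b\<close> the gain \<open>b (s - S) / 4\<close> at \<open>p\<close> exceeds all the other terms.\<close>
  define b where "b = max (depth (F p)) (4 * (R - snd (F p) + (depth (F p))\<^sup>2 / 4 + 1) / (depth (F p) - S))"
  have dp: "depth (F p) \<le> b" by (simp add: b_def)
  have "4 * (R - snd (F p) + (depth (F p))\<^sup>2 / 4 + 1) / (depth (F p) - S) \<le> b" by (simp add: b_def)
  then have big: "4 * (R - snd (F p) + (depth (F p))\<^sup>2 / 4 + 1) \<le> b * (depth (F p) - S)"
    using neg by (simp add: pos_divide_le_eq)
  have strict: "0 < 2 * (- 1/4) * (1 - (e1 \<bullet> h)\<^sup>2) + 2 * 0 * (1 - (e2 \<bullet> h)\<^sup>2)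
         - 2 * 0 * (real CARD('n) - 1 + s\<^sup>2) + (\<lambda>w. 0) w * (1 - s\<^sup>2) + (\<lambda>w. 1) w"
    if "h \<bullet> h + s\<^sup>2 = 1" for h :: "real ^ 'n" and s w :: real
    by (simp add: field_simps add_pos_nonneg)
  have u: "barrier (- 1/4) 0 (b / 4) 0 0 (\<lambda>w. w) y = - (depth y)\<^sup>2 / 4 + b / 4 * depth y + snd y" for y
    by (simp add: barrier_def)
  have "((\<lambda>w::real. w) has_real_derivative 1) (at w)" "((\<lambda>w::real. 1::real) has_real_derivative 0) (at w)" for w
    by (auto intro!: derivative_eq_intros)
  then obtain m where m: "m \<in> topspace X"
    "barrier (- 1/4) 0 (b / 4) 0 0 (\<lambda>w. w) (F p) \<le> barrier (- 1/4) 0 (b / 4) 0 0 (\<lambda>w. w) (F m)"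
    "m \<in> manifold_boundary A \<or> depth (F m) = b"
    using barrier_principle[OF _ _ strict p dp depth_sublevel_subset_bounded] by blast
  have b0: "0 \<le> b" using dp depth_nonneg[OF p] by linarith
  have "barrier (- 1/4) 0 (b / 4) 0 0 (\<lambda>w. w) (F m) \<le> b / 4 * S + R"
    using m(3)
  proof
    assume mb: "m \<in> manifold_boundary A"
    then have "b / 4 * depth (F m) \<le> b / 4 * S" using S b0 by (intro mult_left_mono) auto
    moreover have "0 \<le> (depth (F m))\<^sup>2 / 4" by simp
    ultimately show ?thesis using Z[OF m(1)] unfolding u by linarith
  next
    assume "depth (F m) = b"
    then have "barrier (- 1/4) 0 (b / 4) 0 0 (\<lambda>w. w) (F m) = snd (F m)"
      unfolding u by (simp add: power2_eq_square)
    moreover have "0 \<le> b / 4 * S" using S b0 by simp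
    ultimately show ?thesis using Z[OF m(1)] by linarith
  qed
  then have "- (depth (F p))\<^sup>2 / 4 + b / 4 * depth (F p) + snd (F p) \<le> b / 4 * S + R"
    using m(2) unfolding u by linarith
  then show False using big by (simp add: algebra_simps)
qed

lemma wedge_compact: "compact_space X"
proof -
  obtain R where R: "\<And>m. m \<in> manifold_boundary A \<Longrightarrow> norm (F m) \<le> R"
    using boundary_norm_bound by blast
  define S where "S = max 0 (R + a)"
  have "depth (F m) \<le> S" if "m \<in> manifold_boundary A" for m
  proof -
    have "e1 \<bullet> fst (F m) \<le> norm (fst (F m))" using norm_cauchy_schwarz[of e1 "fst (F m)"] frame by simp
    also have "\<dots> \<le> R" using R[OF that] norm_fst_le[of "fst (F m)" "snd (F m)"] by simp
    finally show ?thesis by (simp add: S_def)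
  qed
  then have "depth (F p) \<le> S" if "p \<in> topspace X" for p
    using depth_le_boundary_depth[of S p] that by (simp add: S_def)
  moreover obtain R' where "\<And>p. p \<in> topspace X \<Longrightarrow> depth (F p) \<le> S \<Longrightarrow> norm (F p) \<le> R'"
    by (rule depth_sublevel_bounded[of S]) (auto simp: S_def)
  ultimately have "{x \<in> topspace X. F x \<in> cball 0 R'} = topspace X" by auto
  moreover have "compactin X {x \<in> topspace X. F x \<in> cball 0 R'}"
    using compactin_proper_map_preimage[OF proper, of "cball 0 R'"] by simp
  ultimately show ?thesis by (simp add: compact_space_def)
qed

end

text \<open>For unit normals \<open>a1\<close> and \<open>a2\<close>, the sum and the difference are orthogonal, and they give the axis
  and the transverse direction of the wedge. The two inequalities add up to
  \<open>\<bar>a1 \<bullet> x - a2 \<bullet> x\<bar> \<le> 2 b - (a1 \<bullet> x + a2 \<bullet> x)\<close>, which is the wedge condition.\<close>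

lemma compact_if_nonparallel_halfspaces:
  fixes X :: "'m topology" and A :: "('m, 'n::finite) chart set"
    and F :: "'m \<Rightarrow> (real ^ 'n) \<times> real"
  assumes F: "self_translater X A F" "proper_map X euclidean F" "compactin X (manifold_boundary A)"
    and unit: "norm a1 = 1" "norm a2 = 1" and nonpar: "a2 \<noteq> a1" "a2 \<noteq> - a1"
    and b: "\<And>x. x \<in> topspace X \<Longrightarrow> a1 \<bullet> fst (F x) \<le> b1" "\<And>x. x \<in> topspace X \<Longrightarrow> a2 \<bullet> fst (F x) \<le> b2"
  shows "compact_space X"
proof -
  define p q b where "p = norm (a1 + a2)" and "q = norm (a1 - a2)" and "b = max b1 b2"
  define e1 e2 where "e1 = - (a1 + a2) /\<^sub>R p" and "e2 = (a1 - a2) /\<^sub>R q"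
  have "a1 + a2 \<noteq> 0" using nonpar(2) by (metis add_eq_0_iff)
  then have pq: "p > 0" "q > 0" using nonpar(1) by (simp_all add: p_def q_def)
  have "norm e1 = 1" "norm e2 = 1" using pq unfolding e1_def e2_def
    by (simp_all add: p_def[symmetric] q_def[symmetric] norm_minus_cancel[of "a1 + a2", simplified])
  moreover have "e1 \<bullet> e2 = 0"
  proof -
    have "(a1 + a2) \<bullet> (a1 - a2) = a1 \<bullet> a1 - a2 \<bullet> a2"
      by (simp add: inner_add_left inner_add_right inner_diff_left inner_diff_right inner_commute)
    also have "\<dots> = 0" using unit by (simp add: dot_square_norm)
    finally show ?thesis by (simp add: e1_def e2_def del: minus_add_distrib)
  qed
  moreover have "\<bar>e2 \<bullet> fst (F x)\<bar> \<le> p / q * (e1 \<bullet> fst (F x) + 2 * b / p)" if x: "x \<in> topspace X" for x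
  proof -
    define s t where "s = a1 \<bullet> fst (F x)" and "t = a2 \<bullet> fst (F x)"
    have st: "s \<le> b" "t \<le> b" using b[OF x] by (auto simp: s_def t_def b_def)
    have e: "e1 \<bullet> fst (F x) = - (s + t) / p" "e2 \<bullet> fst (F x) = (s - t) / q"
      by (simp_all add: e1_def e2_def s_def t_def inner_add_left inner_diff_left divide_inverse algebra_simps)
    have "\<bar>s - t\<bar> \<le> 2 * b - (s + t)" using st by linarith
    then have "\<bar>s - t\<bar> / q \<le> (2 * b - (s + t)) / q" using pq by (intro divide_right_mono) auto
    also have "\<dots> = p / q * (- (s + t) / p + 2 * b / p)" using pq by (simp add: field_simps)
    finally show ?thesis using pq by (simp add: e abs_divide)
  qed
  moreover have "p / q > 0" using pq by simp
  ultimately interpret translater_in_wedge X A F e1 e2 "2 * b / p" "p / q"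
    using F by unfold_locales auto
  show ?thesis by (rule wedge_compact)
qed

section \<open>Convex sets with parallel supports\<close>

lemma nonzero_orthogonal_exists:
  fixes a :: "'a::euclidean_space"
  assumes "DIM('a) \<ge> 2"
  obtains v where "v \<noteq> 0" "a \<bullet> v = 0"
proof -
  have "dim {a} \<le> card {a}" by (rule dim_le_card') simp
  then have "dim {a} < DIM('a)" using assms by simp
  then obtain v where "v \<noteq> 0" "\<And>y. y \<in> span {a} \<Longrightarrow> orthogonal v y"
    using orthogonal_to_subspace_exists[of "{a}"] by blast
  then show ?thesis using that[of v] span_base[of a "{a}"] by (simp add: orthogonal_def inner_commute)
qed

lemma ray_not_bounded:
  fixes v :: "'a::euclidean_space"
  assumes "v \<noteq> 0" "\<And>t. t \<ge> 0 \<Longrightarrow> x + t *\<^sub>R v \<in> C"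
  shows "\<not> bounded C"
proof
  assume "bounded C"
  then obtain R where R: "\<And>y. y \<in> C \<Longrightarrow> norm y \<le> R" by (auto simp: bounded_iff)
  define t where "t = (\<bar>R\<bar> + norm x + 1) / norm v"
  have t: "t \<ge> 0" by (simp add: t_def)
  have "norm (t *\<^sub>R v) = \<bar>R\<bar> + norm x + 1" using assms(1) by (simp add: t_def)
  moreover have "norm (t *\<^sub>R v) \<le> norm (x + t *\<^sub>R v) + norm x"
    using norm_triangle_ineq4[of "x + t *\<^sub>R v" x] by simp
  ultimately show False using R[OF assms(2)[OF t]] by linarith
qed

lemma bounded_linear_ray_zero:
  fixes k l c :: real
  assumes "\<And>t. t \<ge> 0 \<Longrightarrow> l + t * k \<le> c"
  shows "k \<le> 0"
proof (rule ccontr)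
  assume "\<not> k \<le> 0"
  then have "l + ((\<bar>c - l\<bar> + 1) / k) * k \<le> c" by (intro assms) auto
  then show False using \<open>\<not> k \<le> 0\<close> by simp
qed

text \<open>A slab that is a hyperplane contains a segment in its normal direction, hence the whole line, on
  which its linear function would be bounded.\<close>

lemma slab_not_hyperplane:
  assumes "is_closed_slab (C::'a::euclidean_space set)"
  shows "\<not> is_hyperplane C"
proof
  assume "is_hyperplane C"
  then obtain a b where a: "a \<noteq> 0" "C = {x. a \<bullet> x = b}" by (auto simp: is_hyperplane_def)
  obtain d l u where d: "d \<noteq> 0" "l < u" "C = {x. l \<le> d \<bullet> x \<and> d \<bullet> x \<le> u}"
    using assms by (auto simp: is_closed_slab_def)
  have dd: "d \<bullet> d > 0" using d by simp
  define x where "x = (l / (d \<bullet> d)) *\<^sub>R d"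
  define y where "y = ((u - l) / (d \<bullet> d)) *\<^sub>R d"
  have x: "x \<in> C" "x + y \<in> C" using d dd by (simp_all add: x_def y_def inner_add_right)
  then have "a \<bullet> y = 0" using a by (simp add: inner_add_right)
  then have ad: "a \<bullet> d = 0" using d dd by (simp add: y_def)
  have "x + t *\<^sub>R d \<in> C" for t using x a ad by (simp add: inner_add_right)
  then have "d \<bullet> x + t * (d \<bullet> d) \<le> u" for t using d(3) by (auto simp: inner_add_right)
  then have "d \<bullet> d \<le> 0" by (rule bounded_linear_ray_zero)
  then show False using dd by simp
qed

text \<open>A halfspace contains a ray in direction \<open>d\<close> or in direction \<open>- d\<close>, as one of these does not point
  outwards.\<close>

lemma halfspace_not_in_slab:
  assumes "is_halfspace (C::'a::euclidean_space set)" and d: "d \<noteq> 0"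
  shows "\<not> C \<subseteq> {x. l \<le> d \<bullet> x \<and> d \<bullet> x \<le> u}"
proof
  assume sub: "C \<subseteq> {x. l \<le> d \<bullet> x \<and> d \<bullet> x \<le> u}"
  obtain a b where a: "a \<noteq> 0" "C = {x. a \<bullet> x \<le> b}" using assms by (auto simp: is_halfspace_def)
  define x where "x = (b / (a \<bullet> a)) *\<^sub>R a"
  have ax: "a \<bullet> x = b" using a by (simp add: x_def)
  define v where "v = (if a \<bullet> d \<le> 0 then d else - d)"
  have v: "a \<bullet> v \<le> 0" by (simp add: v_def)
  have ray: "x + t *\<^sub>R v \<in> C" if "t \<ge> 0" for t
    using a ax v that by (simp add: inner_add_right mult_nonneg_nonpos)
  have "v \<bullet> x + t * (v \<bullet> v) \<le> max u (- l)" if "t \<ge> 0" for t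
  proof -
    have "l \<le> d \<bullet> (x + t *\<^sub>R v) \<and> d \<bullet> (x + t *\<^sub>R v) \<le> u" using sub ray[OF that] by blast
    then show ?thesis
      by (auto simp: v_def inner_add_right inner_diff_right le_max_iff_disj split: if_splits)
  qed
  then have "v \<bullet> v \<le> 0" by (rule bounded_linear_ray_zero)
  moreover have "v \<noteq> 0" using d by (simp add: v_def)
  ultimately show False using inner_gt_zero_iff[of v] by linarith
qed

lemma slab_not_halfspace: "is_closed_slab C \<Longrightarrow> \<not> is_halfspace C"
  using halfspace_not_in_slab unfolding is_closed_slab_def by blast

lemma hyperplane_not_halfspace: "is_hyperplane C \<Longrightarrow> \<not> is_halfspace C"
  using halfspace_not_in_slab[of C] unfolding is_hyperplane_def by fastforce

lemma UNIV_not_halfspace: "\<not> is_halfspace (UNIV :: 'a::euclidean_space set)"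
proof
  assume "is_halfspace (UNIV :: 'a set)"
  then obtain a :: 'a and b where a: "a \<noteq> 0" "\<And>x. a \<bullet> x \<le> b" by (auto simp: is_halfspace_def)
  have "a \<bullet> 0 + t * (a \<bullet> a) \<le> b" for t using a(2)[of "t *\<^sub>R a"] by simp
  then have "a \<bullet> a \<le> 0" by (rule bounded_linear_ray_zero)
  then show False using a(1) inner_gt_zero_iff[of a] by linarith
qed

lemma UNIV_not_slab: "\<not> is_closed_slab (UNIV :: 'a::euclidean_space set)"
proof
  assume "is_closed_slab (UNIV :: 'a set)"
  then obtain d :: 'a and l u where d: "d \<noteq> 0" "UNIV = {x. l \<le> d \<bullet> x \<and> d \<bullet> x \<le> u}"
    by (auto simp: is_closed_slab_def)
  then have "is_halfspace (UNIV :: 'a set)" unfolding is_halfspace_def by blast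
  then show False using UNIV_not_halfspace by blast
qed

lemma UNIV_not_hyperplane: "\<not> is_hyperplane (UNIV :: 'a::euclidean_space set)"
proof
  assume "is_hyperplane (UNIV :: 'a set)"
  then obtain d :: 'a and l where d: "d \<noteq> 0" "UNIV = {x. d \<bullet> x = l}"
    by (auto simp: is_hyperplane_def)
  then have "UNIV = {x. d \<bullet> x \<le> l}" by auto
  then have "is_halfspace (UNIV :: 'a set)" unfolding is_halfspace_def using d by blast
  then show False using UNIV_not_halfspace by blast
qed

text \<open>This is where the dimension matters: the set contains a line orthogonal to \<open>a\<close>.\<close>

lemma band_not_bounded:
  fixes C :: "'a::euclidean_space set"
  assumes "DIM('a) \<ge> 2" and a: "a \<noteq> 0" and l: "l \<le> u" and C: "{x. l \<le> a \<bullet> x \<and> a \<bullet> x \<le> u} \<subseteq> C"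
  shows "\<not> bounded C"
proof -
  obtain v where v: "v \<noteq> 0" "a \<bullet> v = 0" using nonzero_orthogonal_exists[OF assms(1)] by metis
  have "(l / (a \<bullet> a)) *\<^sub>R a + t *\<^sub>R v \<in> C" for t
    using a v l by (intro subsetD[OF C]) (simp add: inner_add_right)
  then show ?thesis using ray_not_bounded[OF v(1)] by blast
qed

lemma unbounded_models:
  fixes C :: "'a::euclidean_space set"
  assumes "DIM('a) \<ge> 2"
    and "C = UNIV \<or> is_halfspace C \<or> is_closed_slab C \<or> is_hyperplane C"
  shows "\<not> bounded C"
  using assms(2)
proof (elim disjE)
  assume "C = UNIV" then show ?thesis by simp
next
  assume "is_halfspace C"
  then obtain a b where "a \<noteq> 0" "C = {x. a \<bullet> x \<le> b}" by (auto simp: is_halfspace_def)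
  then show ?thesis using band_not_bounded[OF assms(1), of a b b C] by auto
next
  assume "is_closed_slab C"
  then obtain a b c where "a \<noteq> 0" "b < c" "C = {x. b \<le> a \<bullet> x \<and> a \<bullet> x \<le> c}"
    by (auto simp: is_closed_slab_def)
  then show ?thesis using band_not_bounded[OF assms(1), of a b c C] by auto
next
  assume "is_hyperplane C"
  then obtain a b where "a \<noteq> 0" "C = {x. a \<bullet> x = b}" by (auto simp: is_hyperplane_def)
  moreover have "{x. b \<le> a \<bullet> x \<and> a \<bullet> x \<le> b} = {x. a \<bullet> x = b}" by auto
  ultimately show ?thesis using band_not_bounded[OF assms(1), of a b b C] by simp
qed

text \<open>Points outside a closed convex set are separated from it by supporting halfspaces. If their
  normals are all \<open>a\<close> or \<open>- a\<close>, then the set is determined by the values of \<open>a \<bullet> x\<close> on it, which fill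
  a closed interval, bounded below or not.\<close>

lemma parallel_supports_classification:
  fixes C :: "'a::euclidean_space set"
  assumes C: "convex C" "closed C" "C \<noteq> {}"
    and par: "\<And>a a' b b'. norm a = 1 \<Longrightarrow> norm a' = 1 \<Longrightarrow> (\<And>x. x \<in> C \<Longrightarrow> a \<bullet> x \<le> b) \<Longrightarrow>
                 (\<And>x. x \<in> C \<Longrightarrow> a' \<bullet> x \<le> b') \<Longrightarrow> a' = a \<or> a' = - a"
  shows "C = UNIV \<or> is_halfspace C \<or> is_closed_slab C \<or> is_hyperplane C"
proof -
  have sep: "\<exists>a b. norm a = 1 \<and> (\<forall>x\<in>C. a \<bullet> x \<le> b) \<and> b < a \<bullet> y" if "y \<notin> C" for y
  proof -
    obtain a b where ab: "a \<bullet> y < b" "\<And>x. x \<in> C \<Longrightarrow> b < a \<bullet> x"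
      using separating_hyperplane_closed_point[OF C(1,2) \<open>y \<notin> C\<close>] by blast
    obtain z where "z \<in> C" using C(3) by blast
    then have "a \<noteq> 0" using ab(1) ab(2)[of z] by auto
    then have n: "norm a > 0" by simp
    show ?thesis
    proof (intro exI conjI ballI)
      show "norm (- (a /\<^sub>R norm a)) = 1" using n by simp
      show "- (a /\<^sub>R norm a) \<bullet> x \<le> - (b / norm a)" if "x \<in> C" for x
        using ab(2)[OF that] n by (simp add: field_simps)
      show "- (b / norm a) < - (a /\<^sub>R norm a) \<bullet> y"
        using ab(1) n by (simp add: field_simps)
    qed
  qed
  show ?thesis
  proof (cases "C = UNIV")
    case False
    then obtain a b where a: "norm a = 1" and b: "\<And>x. x \<in> C \<Longrightarrow> a \<bullet> x \<le> b"
      using sep by (metis UNIV_eq_I)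
    have a0: "a \<noteq> 0" using a by auto
    define u where "u = Sup ((\<bullet>) a ` C)"
    have above: "bdd_above ((\<bullet>) a ` C)" using b by (auto simp: bdd_above_def)
    have u: "a \<bullet> x \<le> u" if "x \<in> C" for x unfolding u_def using above that by (intro cSup_upper) auto
    have u_le: "u \<le> b'" if "\<And>x. x \<in> C \<Longrightarrow> a \<bullet> x \<le> b'" for b'
      unfolding u_def using C(3) that by (intro cSup_least) auto
    have out: "u < a \<bullet> y \<or> (\<exists>b'. (\<forall>x\<in>C. b' \<le> a \<bullet> x) \<and> a \<bullet> y < b')" if "y \<notin> C" for y
    proof -
      obtain a' b' where a': "norm a' = 1" "\<And>x. x \<in> C \<Longrightarrow> a' \<bullet> x \<le> b'" "b' < a' \<bullet> y"
        using sep[OF \<open>y \<notin> C\<close>] by blast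
      from par[OF a a'(1) b a'(2)] show ?thesis
      proof
        assume "a' = a" then show ?thesis using u_le[of b'] a' by fastforce
      next
        assume neg: "a' = - a"
        have "(\<forall>x\<in>C. - b' \<le> a \<bullet> x) \<and> a \<bullet> y < - b'" using a'(2,3) neg by fastforce
        then show ?thesis by blast
      qed
    qed
    show ?thesis
    proof (cases "bdd_below ((\<bullet>) a ` C)")
      case False
      have "C = {x. a \<bullet> x \<le> u}"
      proof (rule ccontr)
        assume "C \<noteq> {x. a \<bullet> x \<le> u}"
        then obtain y where "y \<notin> C" "a \<bullet> y \<le> u" using u by blast
        then obtain b' where "\<forall>x\<in>C. b' \<le> a \<bullet> x" using out[of y] by auto
        then show False using False by (auto simp: bdd_below_def)
      qed
      then show ?thesis using a0 unfolding is_halfspace_def by blast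
    next
      case True
      define l where "l = Inf ((\<bullet>) a ` C)"
      have l: "l \<le> a \<bullet> x" if "x \<in> C" for x unfolding l_def using True that by (intro cInf_lower) auto
      have l_ge: "b' \<le> l" if "\<And>x. x \<in> C \<Longrightarrow> b' \<le> a \<bullet> x" for b'
        unfolding l_def using C(3) that by (intro cInf_greatest) auto
      have eq: "C = {x. l \<le> a \<bullet> x \<and> a \<bullet> x \<le> u}"
      proof (rule ccontr)
        assume "C \<noteq> {x. l \<le> a \<bullet> x \<and> a \<bullet> x \<le> u}"
        then obtain y where y: "y \<notin> C" "l \<le> a \<bullet> y" "a \<bullet> y \<le> u" using u l by blast
        then obtain b' where "\<forall>x\<in>C. b' \<le> a \<bullet> x" "a \<bullet> y < b'" using out[of y] by auto
        then show False using l_ge[of b'] y by auto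
      qed
      obtain z where "z \<in> C" using C(3) by blast
      then have "l \<le> u" using u[of z] l[of z] by linarith
      then consider "l < u" | "l = u" by linarith
      then show ?thesis
      proof cases
        case 1 then show ?thesis using eq a0 unfolding is_closed_slab_def by blast
      next
        case 2
        then have "C = {x. a \<bullet> x = u}" using eq by auto
        then show ?thesis using a0 unfolding is_hyperplane_def by blast
      qed
    qed
  qed simp
qed

section \<open>The convex hull of the projection\<close>

theorem theorem3:
  fixes X :: "'m topology"
    and A :: "('m, 'n::finite) chart set"
    and F :: "'m \<Rightarrow> (real ^ 'n) \<times> real"
  assumes "CARD('n) \<ge> 2"
    and "self_translater X A F"
    and "proper_map X euclidean F"
    and "connected_space X"
    and "compactin X (manifold_boundary A)"
  defines "C \<equiv> Conv (fst ` F ` topspace X)"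
  shows "(\<exists>!i::nat.
            (i = 1 \<and> C = UNIV) \<or>
            (i = 2 \<and> is_halfspace C) \<or>
            (i = 3 \<and> is_closed_slab C) \<or>
            (i = 4 \<and> is_hyperplane C) \<or>
            (i = 5 \<and> compact C \<and> convex C)) \<and>
         (compact C \<and> convex C \<longleftrightarrow> compact_space X)"
proof -
  have dim: "DIM(real ^ 'n) \<ge> 2" using assms(1) by simp
  have conv: "convex C" "closed C" by (simp_all add: C_def Conv_def convex_closure)
  have inC: "fst (F x) \<in> C" if "x \<in> topspace X" for x
    using that closure_subset hull_subset[of "fst ` F ` topspace X" convex]
    unfolding C_def Conv_def by blast
  show ?thesis
  proof (cases "compact_space X")
    case True
    have "continuous_map X euclidean F"
      using assms(2) smooth_immersion_continuous_map by (auto simp: self_translater_def)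
    then have "compactin euclidean (F ` topspace X)"
      using True by (intro image_compactin[of X]) (auto simp: compact_space_def)
    then have "compact (fst ` F ` topspace X)"
      by (intro compact_continuous_image continuous_intros) auto
    then have cpt: "compact C"
      by (simp add: C_def Conv_def compact_convex_hull compact_imp_closed)
    have excl: "C \<noteq> UNIV" "\<not> is_halfspace C" "\<not> is_closed_slab C" "\<not> is_hyperplane C"
      using unbounded_models[OF dim, of C] compact_imp_bounded[OF cpt] by blast+
    then show ?thesis using True cpt conv(1) by (intro conjI ex1I[of _ 5]) auto
  next
    case False
    then have "topspace X \<noteq> {}" by (auto simp: compact_space_def)
    then have "C \<noteq> {}" using inC by blast
    have model: "C = UNIV \<or> is_halfspace C \<or> is_closed_slab C \<or> is_hyperplane C"
    proof (rule parallel_supports_classification[OF conv \<open>C \<noteq> {}\<close>])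
      fix a a' :: "real ^ 'n" and b b'
      assume "norm a = 1" "norm a' = 1" and "\<And>x. x \<in> C \<Longrightarrow> a \<bullet> x \<le> b" "\<And>x. x \<in> C \<Longrightarrow> a' \<bullet> x \<le> b'"
      then show "a' = a \<or> a' = - a"
        using compact_if_nonparallel_halfspaces[OF assms(2,3,5), of a a' b b'] False inC by blast
    qed
    have unb: "\<not> compact C"
      using unbounded_models[OF dim model] compact_imp_bounded by blast
    have "\<exists>!i::nat. (i = 1 \<and> C = UNIV) \<or> (i = 2 \<and> is_halfspace C) \<or> (i = 3 \<and> is_closed_slab C) \<or>
            (i = 4 \<and> is_hyperplane C) \<or> (i = 5 \<and> compact C \<and> convex C)"
      using model
    proof (elim disjE)
      assume *: "C = UNIV"
      then have "\<not> is_halfspace C" "\<not> is_closed_slab C" "\<not> is_hyperplane C"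
        using UNIV_not_halfspace UNIV_not_slab UNIV_not_hyperplane by blast+
      then show ?thesis using * unb by (intro ex1I[of _ 1]) auto
    next
      assume *: "is_halfspace C"
      then have "C \<noteq> UNIV" "\<not> is_closed_slab C" "\<not> is_hyperplane C"
        using UNIV_not_halfspace slab_not_halfspace hyperplane_not_halfspace by blast+
      then show ?thesis using * unb by (intro ex1I[of _ 2]) auto
    next
      assume *: "is_closed_slab C"
      then have "C \<noteq> UNIV" "\<not> is_halfspace C" "\<not> is_hyperplane C"
        using UNIV_not_slab slab_not_halfspace slab_not_hyperplane by blast+
      then show ?thesis using * unb by (intro ex1I[of _ 3]) auto
    next
      assume *: "is_hyperplane C"
      then have "C \<noteq> UNIV" "\<not> is_halfspace C" "\<not> is_closed_slab C"
        using UNIV_not_hyperplane slab_not_hyperplane hyperplane_not_halfspace by blast+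
      then show ?thesis using * unb by (intro ex1I[of _ 4]) auto
    qed
    then show ?thesis using unb False by blast
  qed
qed

end
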